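(* Let $G_1,G_2$ be connected graphs and let $\phi:G_1\to G_2$ be a strongly line-proper morphism. Then, under the canonical identifications $\mathrm{Ult}(\mathfrak C(G_i))\cong\mathcal D_E(G_i)\cong\Omega(L(G_i))$ ($i=1,2$), the maps $\mathrm{Ult}(\mathfrak C(\phi))$ and $\Omega(L(\phi))$ are equal. Denote this common map by $\mathcal D_E(\phi):\mathcal D_E(G_1)\to\mathcal D_E(G_2)$. Explicitly: (a) $\mathcal D_E(\phi)$ maps a direction $\rho_v\in\mathcal D_E(G_1)$ given by an infinite degree vertex $v\in V(G_1)$ to the direction $\rho_{\phi(v)}\in\mathcal D_E(G_2)$ given by the vertex $\phi(v)\in V(G_2)$, which is also of infinite degree; (b) $\mathcal D_E(\phi)$ maps a direction $\rho_r\in\mathcal D_E(G_1)$ given by a ray $r\subset V(G_1)$ to the unique direction $\rho_{\phi(r)}\in\mathcal D_E(G_2)$ that always picks a connected component intersecting $\phi(r)\subset V(G_2)$, that is, the unique direction such that for every finite $F\subset E(G_2)$ the component $\rho_{\phi(r)}(F)$ of $G_2\setminus F$ contains a vertex of $\phi(r)$.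
   Context: Graphs are simple and undirected, possibly infinite. A graph homomorphism is a map of vertex sets sending adjacent vertices to adjacent vertices; a 1-complex morphism sends adjacent vertices either to adjacent vertices or to a single vertex. A ray is a one-way infinite path without repeated vertices. Line graph. $L(G)$ has vertex set $E(G)$, two distinct edges being adjacent when they share a vertex. A graph homomorphism $\phi:G_1\to G_2$ induces the 1-complex morphism $L(\phi):L(G_1)\to L(G_2)$, $L(\phi)(\{u,v\})=\{\phi(u),\phi(v)\}$. A strongly line-proper morphism is a graph homomorphism $\phi$ such that $L(\phi)^{-1}(e)$ is finite for every $e\in E(G_2)$. Strongly proper. $U\subset V(H)$ is dispersed if for every ray $r$ of $H$ there is a finite $F\subset V(H)$ such that the component of $H\setminus F$ containing a tail of $r$ is disjoint from $U$. A 1-complex morphism $\psi:H_1\to H_2$ is strongly proper if all fibers $\psi^{-1}(v)$ are dispersed. If $\phi$ is strongly line-proper (between connected graphs) then $L(\phi)$ is strongly proper. Ends. Two rays of $H$ are equivalent if there are infinitely many pairwise disjoint (possibly trivial) paths joining them; $\Omega(H)$ is the set of equivalence classes (ends). For finite $F\subset V(H)$, $C(F,\varepsilon)$ is the component of $H\setminus F$ containing tails of all rays in $\varepsilon$; the sets $\{\eta : C(F,\eta)=C(F,\varepsilon)\}$ form a basis of the topology. For a strongly proper $\psi:H_1\to H_2$, the map $\Omega(\psi):\Omega(H_1)\to\Omega(H_2)$ sends $[r]$ to $[s]$, where $s$ is any ray contained in $\psi(r)$; it is well defined and continuous, and $\Omega(\psi)([r])$ is the only end of $H_2$ that cannot be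 separated from $\psi(r)$ by deleting finitely many vertices. Cut algebra. $\mathfrak c(G)$ is the Boolean algebra of sets $A\subset V(G)$ joined to their complement by only finitely many edges; $I_G$ is the ideal of finite sets of vertices of finite degree; $\mathfrak C(G)=\mathfrak c(G)/I_G$. For $\phi$ strongly line-proper, $\mathfrak C(\phi):\mathfrak C(G_2)\to\mathfrak C(G_1)$ is the well-defined homomorphism $A\mapsto\phi^{-1}(A)$. $\mathrm{Ult}(\mathfrak B)$ is the set of ultrafilters of $\mathfrak B$ with basic open sets $\{u : B\in u\}$, and for a homomorphism $h:\mathfrak B_1\to\mathfrak B_2$, $\mathrm{Ult}(h):\mathrm{Ult}(\mathfrak B_2)\to\mathrm{Ult}(\mathfrak B_1)$ is $u\mapsto h^{-1}[u]$. Edge-directions. For finite $F\subset E(G)$ let $\mathcal S^E_F$ be the set of infinite components of $G\setminus F$ (edges of $F$ deleted). $\mathcal D_E(G)$ is the set of functions $\rho$ with $\rho(F)\in\mathcal S^E_F$ for all finite $F\subset E(G)$ and $\rho(F')\subset\rho(F)$ whenever $F\subset F'$, with basic open sets $\{\rho' : \rho'(F)=\rho(F)\}$. For a vertex $v$ of infinite degree, $\rho_v(F)$ is the component of $G\setminus F$ containing $v$; for a ray $r$, $\rho_r(F)$ is the component of $G\setminus F$ containing a tail of $r$. Every edge-direction is given by an infinite degree vertex or by a ray in this way. Identifications, for $G$ connected. $\mathrm{Ult}(\mathfrak C(G))\cong\mathcal D_E(G)$ sends $u$ to $\rho_u$, where $\rho_u(F)$ is the unique component of $G\setminus F$ whose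 vertex set represents an element of $u$. $\Omega(L(G))\cong\mathcal D_E(G)$ sends an end $\varepsilon$ of $L(G)$ to the direction $\rho_\varepsilon$ such that, for finite $F\subset E(G)=V(L(G))$, $\rho_\varepsilon(F)$ is the component of $G\setminus F$ whose edge set is the vertex set of $C(F,\varepsilon)$. Both are homeomorphisms.
   Formalization: In (b) uniqueness fails as stated if φ(r) has an infinite degree vertex giving another direction; proved instead: the image direction is the unique one always meeting every tail of φ(r), and the unique one always meeting φ(r) apart from directions of infinite degree vertices of φ(r). *)

theory Defs
  imports "HOL-Analysis.Abstract_Topology" "HOL-Library.FuncSet"
begin

record 'a graph =
  verts :: "'a set"
  edges :: "'a set set"

definition simple_graph :: "'a graph \<Rightarrow> bool" where
  "simple_graph G \<longleftrightarrow> (\<forall>e\<in>edges G. \<exists>u\<in>verts G. \<exists>v\<in>verts G. u \<noteq> v \<and> e = {u, v})"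

text \<open>Components are represented by their vertex sets.\<close>

definition component_of :: "'a graph \<Rightarrow> 'a \<Rightarrow> 'a set" where
  "component_of G v = {w. (v, w) \<in> {(x, y). {x, y} \<in> edges G}\<^sup>*}"

definition graph_components :: "'a graph \<Rightarrow> 'a set set" where
  "graph_components G = component_of G ` verts G"

definition connected_graph :: "'a graph \<Rightarrow> bool" where
  "connected_graph G \<longleftrightarrow> (\<forall>u\<in>verts G. \<forall>v\<in>verts G. v \<in> component_of G u)"

definition del_edges :: "'a graph \<Rightarrow> 'a set set \<Rightarrow> 'a graph" where
  "del_edges G F = \<lparr>verts = verts G, edges = edges G - F\<rparr>"

definition del_verts :: "'a graph \<Rightarrow> 'a set \<Rightarrow> 'a graph" where
  "del_verts G F = \<lparr>verts = verts G - F, edges = {e \<in> edges G. e \<inter> F = {}}\<rparr>"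

definition infinite_degree :: "'a graph \<Rightarrow> 'a \<Rightarrow> bool" where
  "infinite_degree G v \<longleftrightarrow> v \<in> verts G \<and> infinite {e \<in> edges G. v \<in> e}"

definition graph_hom :: "'a graph \<Rightarrow> 'b graph \<Rightarrow> ('a \<Rightarrow> 'b) \<Rightarrow> bool" where
  "graph_hom G1 G2 \<phi> \<longleftrightarrow>
     \<phi> ` verts G1 \<subseteq> verts G2 \<and> (\<forall>u v. {u, v} \<in> edges G1 \<longrightarrow> {\<phi> u, \<phi> v} \<in> edges G2)"

definition line_graph :: "'a graph \<Rightarrow> 'a set graph" where
  "line_graph G = \<lparr>verts = edges G,
     edges = {{e, f} |e f. e \<in> edges G \<and> f \<in> edges G \<and> e \<noteq> f \<and> e \<inter> f \<noteq> {}}\<rparr>"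

text \<open>On an edge \<open>{u, v}\<close> this is \<open>{\<phi> u, \<phi> v}\<close>.\<close>

definition line_map :: "('a \<Rightarrow> 'b) \<Rightarrow> 'a set \<Rightarrow> 'b set" where
  "line_map \<phi> e = \<phi> ` e"

definition strongly_line_proper :: "'a graph \<Rightarrow> 'b graph \<Rightarrow> ('a \<Rightarrow> 'b) \<Rightarrow> bool" where
  "strongly_line_proper G1 G2 \<phi> \<longleftrightarrow>
     graph_hom G1 G2 \<phi> \<and> (\<forall>e\<in>edges G2. finite {e' \<in> edges G1. line_map \<phi> e' = e})"

definition ray :: "'a graph \<Rightarrow> (nat \<Rightarrow> 'a) \<Rightarrow> bool" where
  "ray H r \<longleftrightarrow> inj r \<and> range r \<subseteq> verts H \<and> (\<forall>n. {r n, r (Suc n)} \<in> edges H)"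

definition has_tail_in :: "(nat \<Rightarrow> 'a) \<Rightarrow> 'a set \<Rightarrow> bool" where
  "has_tail_in r K \<longleftrightarrow> (\<exists>n. \<forall>m\<ge>n. r m \<in> K)"

text \<open>A path is given by its list of vertices; the trivial paths are the singleton lists.\<close>

definition graph_path :: "'a graph \<Rightarrow> 'a list \<Rightarrow> bool" where
  "graph_path H p \<longleftrightarrow>
     p \<noteq> [] \<and> distinct p \<and> set p \<subseteq> verts H \<and> successively (\<lambda>u v. {u, v} \<in> edges H) p"

definition ray_equiv :: "'a graph \<Rightarrow> ((nat \<Rightarrow> 'a) \<times> (nat \<Rightarrow> 'a)) set" where
  "ray_equiv H = {(r, s). ray H r \<and> ray H s \<and>
     (\<exists>P. infinite P \<and> (\<forall>p\<in>P. graph_path H p \<and> hd p \<in> range r \<and> last p \<in> range s) \<and>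
          pairwise (\<lambda>p q. disjnt (set p) (set q)) P)}"

definition ends :: "'a graph \<Rightarrow> (nat \<Rightarrow> 'a) set set" where
  "ends H = {r. ray H r} // ray_equiv H"

definition end_component :: "'a graph \<Rightarrow> 'a set \<Rightarrow> (nat \<Rightarrow> 'a) set \<Rightarrow> 'a set" where
  "end_component H F \<epsilon> =
     (THE K. K \<in> graph_components (del_verts H F) \<and> (\<forall>r\<in>\<epsilon>. has_tail_in r K))"

definition end_topology :: "'a graph \<Rightarrow> (nat \<Rightarrow> 'a) set topology" where
  "end_topology H = topology_generated_by
     {{\<eta> \<in> ends H. end_component H F \<eta> = end_component H F \<epsilon>} |F \<epsilon>.
        finite F \<and> F \<subseteq> verts H \<and> \<epsilon> \<in> ends H}"

text \<open>\<open>s\<close> is a ray of the subgraph \<open>\<psi>(r)\<close>: each edge of \<open>s\<close> is the image of an edge of \<open>r\<close>.\<close>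

definition ray_in_image :: "'b graph \<Rightarrow> ('a \<Rightarrow> 'b) \<Rightarrow> (nat \<Rightarrow> 'a) \<Rightarrow> (nat \<Rightarrow> 'b) \<Rightarrow> bool" where
  "ray_in_image H2 \<psi> r s \<longleftrightarrow>
     ray H2 s \<and> (\<forall>i. \<exists>j. {s i, s (Suc i)} = {\<psi> (r j), \<psi> (r (Suc j))})"

text \<open>The map \<open>[r] \<mapsto> [s]\<close>, for any ray \<open>s\<close> contained in \<open>\<psi>(r)\<close>. If \<open>\<psi>\<close> is strongly proper, all
  the classes in the union coincide, so that the union is a single end.\<close>

definition end_map :: "'b graph \<Rightarrow> ('a \<Rightarrow> 'b) \<Rightarrow> (nat \<Rightarrow> 'a) set \<Rightarrow> (nat \<Rightarrow> 'b) set" where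
  "end_map H2 \<psi> \<epsilon> = (\<Union>r\<in>\<epsilon>. \<Union>s\<in>{s. ray_in_image H2 \<psi> r s}. ray_equiv H2 `` {s})"

record 'a bool_alg =
  ba_carrier :: "'a set"
  ba_meet :: "'a \<Rightarrow> 'a \<Rightarrow> 'a"
  ba_join :: "'a \<Rightarrow> 'a \<Rightarrow> 'a"
  ba_compl :: "'a \<Rightarrow> 'a"
  ba_zero :: 'a
  ba_one :: 'a

definition ba_le :: "'a bool_alg \<Rightarrow> 'a \<Rightarrow> 'a \<Rightarrow> bool" where
  "ba_le B a b \<longleftrightarrow> ba_meet B a b = a"

definition Ult :: "'a bool_alg \<Rightarrow> 'a set set" where
  "Ult B = {u. u \<subseteq> ba_carrier B \<and> ba_one B \<in> u \<and> ba_zero B \<notin> u \<and>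
     (\<forall>a\<in>u. \<forall>b\<in>u. ba_meet B a b \<in> u) \<and>
     (\<forall>a\<in>u. \<forall>b\<in>ba_carrier B. ba_le B a b \<longrightarrow> b \<in> u) \<and>
     (\<forall>a\<in>ba_carrier B. a \<in> u \<or> ba_compl B a \<in> u)}"

definition ult_topology :: "'a bool_alg \<Rightarrow> 'a set topology" where
  "ult_topology B = topology_generated_by {{u \<in> Ult B. b \<in> u} |b. b \<in> ba_carrier B}"

text \<open>For a homomorphism \<open>h\<close> defined on \<open>B1\<close>, the preimage of an ultrafilter under \<open>h\<close>.\<close>

definition ult_map :: "'a bool_alg \<Rightarrow> ('a \<Rightarrow> 'b) \<Rightarrow> 'b set \<Rightarrow> 'a set" where
  "ult_map B1 h u = {b \<in> ba_carrier B1. h b \<in> u}"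

definition cut_sets :: "'a graph \<Rightarrow> 'a set set" where
  "cut_sets G = {A. A \<subseteq> verts G \<and> finite {e \<in> edges G. e \<inter> A \<noteq> {} \<and> e \<inter> (verts G - A) \<noteq> {}}}"

definition cut_ideal :: "'a graph \<Rightarrow> 'a set set" where
  "cut_ideal G = {A. A \<subseteq> verts G \<and> finite A \<and> (\<forall>v\<in>A. \<not> infinite_degree G v)}"

definition cut_rel :: "'a graph \<Rightarrow> ('a set \<times> 'a set) set" where
  "cut_rel G = {(A, B). A \<in> cut_sets G \<and> B \<in> cut_sets G \<and> (A - B) \<union> (B - A) \<in> cut_ideal G}"

definition cut_algebra :: "'a graph \<Rightarrow> 'a set set bool_alg" where
  "cut_algebra G = \<lparr>
     ba_carrier = cut_sets G // cut_rel G,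
     ba_meet = (\<lambda>X Y. \<Union>A\<in>X. \<Union>B\<in>Y. cut_rel G `` {A \<inter> B}),
     ba_join = (\<lambda>X Y. \<Union>A\<in>X. \<Union>B\<in>Y. cut_rel G `` {A \<union> B}),
     ba_compl = (\<lambda>X. \<Union>A\<in>X. cut_rel G `` {verts G - A}),
     ba_zero = cut_rel G `` {{}},
     ba_one = cut_rel G `` {verts G}\<rparr>"

definition cut_hom :: "'a graph \<Rightarrow> ('a \<Rightarrow> 'b) \<Rightarrow> 'b set set \<Rightarrow> 'a set set" where
  "cut_hom G1 \<phi> X = (\<Union>A\<in>X. cut_rel G1 `` {\<phi> -` A \<inter> verts G1})"

definition fin_edge_sets :: "'a graph \<Rightarrow> 'a set set set" where
  "fin_edge_sets G = {F. finite F \<and> F \<subseteq> edges G}"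

text \<open>Directions are extensional functions on the finite edge sets, so that equality of directions
  is equality in HOL.\<close>

definition edge_directions :: "'a graph \<Rightarrow> ('a set set \<Rightarrow> 'a set) set" where
  "edge_directions G =
     {\<rho> \<in> (\<Pi>\<^sub>E F\<in>fin_edge_sets G. {K \<in> graph_components (del_edges G F). infinite K}).
        \<forall>F\<in>fin_edge_sets G. \<forall>F'\<in>fin_edge_sets G. F \<subseteq> F' \<longrightarrow> \<rho> F' \<subseteq> \<rho> F}"

definition edge_direction_topology :: "'a graph \<Rightarrow> ('a set set \<Rightarrow> 'a set) topology" where
  "edge_direction_topology G = topology_generated_by
     {{\<rho>' \<in> edge_directions G. \<rho>' F = \<rho> F} |F \<rho>. F \<in> fin_edge_sets G \<and> \<rho> \<in> edge_directions G}"

definition vertex_direction :: "'a graph \<Rightarrow> 'a \<Rightarrow> 'a set set \<Rightarrow> 'a set" where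
  "vertex_direction G v = (\<lambda>F\<in>fin_edge_sets G. component_of (del_edges G F) v)"

definition ray_direction :: "'a graph \<Rightarrow> (nat \<Rightarrow> 'a) \<Rightarrow> 'a set set \<Rightarrow> 'a set" where
  "ray_direction G r =
     (\<lambda>F\<in>fin_edge_sets G. THE K. K \<in> graph_components (del_edges G F) \<and> has_tail_in r K)"

definition always_meets :: "'a graph \<Rightarrow> ('a set set \<Rightarrow> 'a set) \<Rightarrow> 'a set \<Rightarrow> bool" where
  "always_meets G \<rho> S \<longleftrightarrow> (\<forall>F\<in>fin_edge_sets G. \<rho> F \<inter> S \<noteq> {})"

definition ult_to_direction :: "'a graph \<Rightarrow> 'a set set set \<Rightarrow> 'a set set \<Rightarrow> 'a set" where
  "ult_to_direction G u =
     (\<lambda>F\<in>fin_edge_sets G. THE K. K \<in> graph_components (del_edges G F) \<and> cut_rel G `` {K} \<in> u)"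

text \<open>The edge set of a component \<open>K\<close> of \<open>del_edges G F\<close> consists of the edges of
  \<open>del_edges G F\<close> contained in \<open>K\<close>.\<close>

definition end_to_direction :: "'a graph \<Rightarrow> (nat \<Rightarrow> 'a set) set \<Rightarrow> 'a set set \<Rightarrow> 'a set" where
  "end_to_direction G \<epsilon> =
     (\<lambda>F\<in>fin_edge_sets G. THE K. K \<in> graph_components (del_edges G F) \<and>
        {e \<in> edges (del_edges G F). e \<subseteq> K} = end_component (line_graph G) F \<epsilon>)"

text \<open>The maps induced by \<open>\<phi>\<close> on ultrafilters and on ends of line graphs, transported to
  edge-directions.\<close>

definition direction_map_ult ::
  "'a graph \<Rightarrow> 'b graph \<Rightarrow> ('a \<Rightarrow> 'b) \<Rightarrow> ('a set set \<Rightarrow> 'a set) \<Rightarrow> ('b set set \<Rightarrow> 'b set)" where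
  "direction_map_ult G1 G2 \<phi> = (\<lambda>\<rho>\<in>edge_directions G1.
     ult_to_direction G2 (ult_map (cut_algebra G2) (cut_hom G1 \<phi>)
       (inv_into (Ult (cut_algebra G1)) (ult_to_direction G1) \<rho>)))"

definition direction_map_end ::
  "'a graph \<Rightarrow> 'b graph \<Rightarrow> ('a \<Rightarrow> 'b) \<Rightarrow> ('a set set \<Rightarrow> 'a set) \<Rightarrow> ('b set set \<Rightarrow> 'b set)" where
  "direction_map_end G1 G2 \<phi> = (\<lambda>\<rho>\<in>edge_directions G1.
     end_to_direction G2 (end_map (line_graph G2) (line_map \<phi>)
       (inv_into (ends (line_graph G1)) (end_to_direction G1) \<rho>)))"

text \<open>Bijectivity of the identifications gives the inverses in the transported maps their intended
  meaning.\<close>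

definition canonical_identifications :: "'a graph \<Rightarrow> bool" where
  "canonical_identifications G \<longleftrightarrow>
     homeomorphic_map (ult_topology (cut_algebra G)) (edge_direction_topology G) (ult_to_direction G) \<and>
     homeomorphic_map (end_topology (line_graph G)) (edge_direction_topology G) (end_to_direction G)"

text \<open>A direction that meets the image of a ray for every finite \<open>F\<close> need not be the direction of that
  image: on a ray with infinitely many leaves attached to its first vertex, the direction of the first
  vertex also always meets the ray. Uniqueness therefore has to be expressed by tails of the image
  (meeting \<open>\<phi> ` r ` {n..}\<close> for every \<open>n\<close>), or up to the directions of infinite degree vertices of the
  image.\<close>

end

theory Submission
  imports Defs
begin

text \<open>Both induced maps send a direction \<open>\<rho>\<close> of \<open>G1\<close> to the same direction of \<open>G2\<close>: its value at \<open>F\<close>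
  is the component of \<open>G2 - F\<close> containing the image of \<open>\<rho> (\<phi>\<^sup>-\<^sup>1 F)\<close>, where \<open>\<phi>\<^sup>-\<^sup>1 F\<close> is finite because
  \<open>\<phi>\<close> is strongly line-proper. For ultrafilters this holds because \<open>[A] \<in> u\<close> iff \<open>\<rho>\<^sub>u F \<subseteq> A\<close> for any
  finite \<open>F\<close> containing the boundary of \<open>A\<close>; for ends because the image of a ray of the line graph
  visits every edge finitely often, hence contains rays, and all of these share its tails. The
  hard part of the identifications is that every direction comes from an end: if no vertex
  belongs to all \<open>\<rho> F\<close>, some sequence of nested \<open>\<rho> (F n)\<close> has empty intersection, and a ray is
  steered through it.\<close>

text \<open>Both induced maps involve choices: \<open>inv_into\<close>, definite descriptions,
  unions over representatives. They are evaluated at one finite \<open>F\<close> at a time, by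
  exhibiting a component with the characteristic property. Two components of the same graph with a
  common vertex coincide, so most equalities below come down to finding such a vertex. A direction
  may be given by a vertex of infinite degree and by no ray of \<open>G\<close>. The line graph
  repairs this: the edges at such a vertex are pairwise adjacent there, so any injective enumeration
  of infinitely many of them is a ray. Hence the two cases in the proof that every direction comes
  from an end. The same vertices determine the form of uniqueness in (b). A direction that meets a
  fixed finite vertex set for every \<open>F\<close> is the direction of an infinite degree vertex
  in that set, and this is the only way in which a direction other than that of the image can always
  meet the image of a ray.\<close>

lemma del_edges_simps [simp]:
  "verts (del_edges G F) = verts G" "edges (del_edges G F) = edges G - F"
  by (simp_all add: del_edges_def)

lemma del_verts_simps [simp]:
  "verts (del_verts G F) = verts G - F"
  "edges (del_verts G F) = {e \<in> edges G. e \<inter> F = {}}"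
  by (simp_all add: del_verts_def)

lemma verts_line_graph [simp]: "verts (line_graph G) = edges G"
  by (simp add: line_graph_def)

lemma edges_line_graph_iff:
  "{e, f} \<in> edges (line_graph G) \<longleftrightarrow> e \<in> edges G \<and> f \<in> edges G \<and> e \<noteq> f \<and> e \<inter> f \<noteq> {}"
  by (auto simp: line_graph_def doubleton_eq_iff)

lemma simple_graphD:
  assumes "simple_graph G" "{x, y} \<in> edges G"
  shows "x \<in> verts G" "y \<in> verts G" "x \<noteq> y"
  using assms unfolding simple_graph_def by (fastforce simp: doubleton_eq_iff)+

lemma simple_graph_edgeE:
  assumes "simple_graph G" "e \<in> edges G"
  obtains x y where "x \<noteq> y" "e = {x, y}" "x \<in> verts G" "y \<in> verts G"
  using assms unfolding simple_graph_def by blast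

lemma simple_graph_edge:
  assumes "simple_graph G" "e \<in> edges G"
  shows "e \<noteq> {}" "finite e" "e \<subseteq> verts G"
  using assms unfolding simple_graph_def by fastforce+

lemma simple_del_edges [simp]: "simple_graph G \<Longrightarrow> simple_graph (del_edges G F)"
  by (simp add: simple_graph_def)

lemma simple_del_verts [simp]: "simple_graph G \<Longrightarrow> simple_graph (del_verts G F)"
  unfolding simple_graph_def by fastforce

lemma simple_line_graph [simp]: "simple_graph (line_graph G)"
  unfolding simple_graph_def by (auto simp: line_graph_def)

subsection \<open>Components\<close>

lemma component_of_refl [simp]: "v \<in> component_of G v"
  by (simp add: component_of_def)

lemma component_of_step:
  "w \<in> component_of G v \<Longrightarrow> {w, x} \<in> edges G \<Longrightarrow> x \<in> component_of G v"
  by (auto simp: component_of_def intro: rtrancl_into_rtrancl)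

text \<open>Replaces induction on walks throughout: a property of all vertices of a component is
  proved by checking that it survives one step.\<close>

lemma component_of_least:
  assumes "v \<in> S" "\<And>x y. x \<in> S \<Longrightarrow> {x, y} \<in> edges G \<Longrightarrow> y \<in> S"
  shows "component_of G v \<subseteq> S"
proof
  fix w assume "w \<in> component_of G v"
  then have "(v, w) \<in> {(x, y). {x, y} \<in> edges G}\<^sup>*" by (simp add: component_of_def)
  then show "w \<in> S" by induction (use assms in auto)
qed

lemma component_of_sym: "w \<in> component_of G v \<Longrightarrow> v \<in> component_of G w"
proof -
  have "sym {(x, y). {x, y} \<in> edges G}" by (auto simp: sym_def insert_commute)
  from sym_rtrancl[OF this] show "w \<in> component_of G v \<Longrightarrow> v \<in> component_of G w"
    by (auto simp: component_of_def dest: symD)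
qed

lemma component_of_trans:
  "w \<in> component_of G v \<Longrightarrow> x \<in> component_of G w \<Longrightarrow> x \<in> component_of G v"
  unfolding component_of_def by auto

lemma component_of_eq: "w \<in> component_of G v \<Longrightarrow> component_of G w = component_of G v"
  by (blast intro: component_of_trans component_of_sym)

lemma component_of_mono: "edges G \<subseteq> edges H \<Longrightarrow> component_of G v \<subseteq> component_of H v"
  by (rule component_of_least) (auto intro: component_of_step)

lemma component_of_subset_verts:
  "simple_graph G \<Longrightarrow> v \<in> verts G \<Longrightarrow> component_of G v \<subseteq> verts G"
  by (rule component_of_least) (auto dest: simple_graphD)

lemma component_of_in_components [simp]: "v \<in> verts G \<Longrightarrow> component_of G v \<in> graph_components G"
  by (simp add: graph_components_def)

lemma components_eq_component_of:
  "K \<in> graph_components G \<Longrightarrow> v \<in> K \<Longrightarrow> K = component_of G v"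
  unfolding graph_components_def using component_of_eq by (metis imageE)

lemma components_eqI:
  "K \<in> graph_components G \<Longrightarrow> K' \<in> graph_components G \<Longrightarrow> x \<in> K \<Longrightarrow> x \<in> K' \<Longrightarrow> K = K'"
  using components_eq_component_of by metis

lemma components_nonempty: "K \<in> graph_components G \<Longrightarrow> K \<noteq> {}"
  unfolding graph_components_def using component_of_refl by fast

lemma components_step:
  "K \<in> graph_components G \<Longrightarrow> x \<in> K \<Longrightarrow> {x, y} \<in> edges G \<Longrightarrow> y \<in> K"
  by (auto simp: graph_components_def intro: component_of_step)

lemma components_subset_verts:
  "simple_graph G \<Longrightarrow> K \<in> graph_components G \<Longrightarrow> K \<subseteq> verts G"
  unfolding graph_components_def by (metis component_of_subset_verts imageE)

lemma components_del_edges_mono: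
  assumes "K' \<in> graph_components (del_edges G F')" "F \<subseteq> F'"
  shows "\<exists>K\<in>graph_components (del_edges G F). K' \<subseteq> K"
proof -
  obtain v where v: "v \<in> verts G" "K' = component_of (del_edges G F') v"
    using assms(1) by (auto simp: graph_components_def)
  show ?thesis
  proof (rule bexI)
    show "K' \<subseteq> component_of (del_edges G F) v"
      unfolding v by (rule component_of_mono) (use assms(2) in auto)
  qed (simp add: v)
qed

lemma components_del_edges_subset:
  assumes "K \<in> graph_components (del_edges G F)" "K' \<in> graph_components (del_edges G F')"
    and "F \<subseteq> F'" "K \<inter> K' \<noteq> {}"
  shows "K' \<subseteq> K"
proof -
  obtain L where L: "L \<in> graph_components (del_edges G F)" "K' \<subseteq> L"
    using components_del_edges_mono[OF assms(2,3)] by blast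
  obtain x where "x \<in> K" "x \<in> K'" using assms(4) by blast
  then have "K = L" using components_eqI[OF assms(1) L(1)] L(2) by blast
  then show ?thesis using L(2) by simp
qed

text \<open>The endpoints of \<open>F\<close> witness that only finitely many components arise.\<close>

lemma finite_components_del_edges:
  assumes "simple_graph G" "connected_graph G" "finite F" "F \<subseteq> edges G"
  shows "finite (graph_components (del_edges G F))"
proof -
  \<comment> \<open>\<open>verts G\<close> covers a component without endpoints of \<open>F\<close>:
    it is closed under adjacency in \<open>G\<close> itself, hence everything by
    connectedness.\<close>
  have "K \<in> insert (verts G) (component_of (del_edges G F) ` \<Union>F)"
    if K: "K \<in> graph_components (del_edges G F)" for K
  proof (cases "K \<inter> \<Union>F = {}")
    case True
    obtain v where v: "v \<in> K" using components_nonempty[OF K] by blast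
    have Ks: "K \<subseteq> verts G" using components_subset_verts[OF _ K] assms(1) by simp
    have "component_of G v \<subseteq> K"
      by (rule component_of_least[OF v], rule components_step[OF K]) (use True in auto)
    then have "K = verts G" using Ks v assms(2) by (auto simp: connected_graph_def)
    then show ?thesis by simp
  next
    case False
    then show ?thesis using components_eq_component_of[OF K] by blast
  qed
  moreover have "finite (\<Union>F)" using assms simple_graph_edge(2)[OF assms(1)] by auto
  ultimately show ?thesis
    by (meson finite_imageI finite_insert finite_subset subsetI)
qed

lemma finite_edges_subset:
  assumes "simple_graph G" "finite S"
  shows "finite {e \<in> edges G. e \<subseteq> S}"
  by (rule finite_subset[of _ "Pow S"]) (use assms in auto)

subsection \<open>Tails and rays\<close>

lemma has_tail_in_iff: "has_tail_in r K \<longleftrightarrow> (\<forall>\<^sub>F n in sequentially. r n \<in> K)"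
  by (simp add: has_tail_in_def eventually_sequentially)

lemma has_tail_in_mono: "has_tail_in r K \<Longrightarrow> K \<subseteq> K' \<Longrightarrow> has_tail_in r K'"
  by (auto simp: has_tail_in_def)

lemma has_tail_in_Int: "has_tail_in r K \<Longrightarrow> has_tail_in r K' \<Longrightarrow> has_tail_in r (K \<inter> K')"
  by (simp add: has_tail_in_iff eventually_conj)

lemma has_tail_in_meets: "has_tail_in r K \<Longrightarrow> \<exists>m\<ge>n. r m \<in> K"
  unfolding has_tail_in_def by (metis nle_le)

lemma has_tail_in_both: "has_tail_in r K \<Longrightarrow> has_tail_in r K' \<Longrightarrow> \<exists>m. r m \<in> K \<and> r m \<in> K'"
  using has_tail_in_Int has_tail_in_meets by fastforce

lemma tail_component_unique:
  "K \<in> graph_components H \<Longrightarrow> K' \<in> graph_components H \<Longrightarrow> has_tail_in r K \<Longrightarrow> has_tail_in r K' \<Longrightarrow> K = K'"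
  by (meson has_tail_in_both components_eqI)

lemma has_tail_in_avoid:
  assumes "\<And>x. x \<in> F \<Longrightarrow> finite {i. w i = x}" "finite F"
  shows "has_tail_in w (- F)"
proof -
  have "finite (\<Union>x\<in>F. {i. w i = x})" using assms by blast
  moreover have "(\<Union>x\<in>F. {i. w i = x}) = {i. w i \<in> F}" by auto
  ultimately show ?thesis
    by (simp add: has_tail_in_iff cofinite_eq_sequentially[symmetric] eventually_cofinite)
qed

lemma inj_has_tail_in_avoid: "inj w \<Longrightarrow> finite F \<Longrightarrow> has_tail_in w (- F)"
proof (rule has_tail_in_avoid)
  assume "inj w"
  then show "finite {i. w i = x}" for x
    using finite_vimageI[of "{x}" w] by (simp add: vimage_def)
qed

lemma inj_tail_infinite: "inj r \<Longrightarrow> has_tail_in r K \<Longrightarrow> infinite K"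
  using inj_has_tail_in_avoid has_tail_in_both by fastforce

lemma walk_tail_in_component:
  assumes "\<forall>\<^sub>F n in sequentially. w n \<in> verts H"
    and "\<forall>\<^sub>F n in sequentially. w (Suc n) = w n \<or> {w n, w (Suc n)} \<in> edges H"
  shows "\<exists>K\<in>graph_components H. has_tail_in w K"
proof -
  from eventually_conj[OF assms] obtain N
    where N: "\<And>n. n \<ge> N \<Longrightarrow> w n \<in> verts H \<and> (w (Suc n) = w n \<or> {w n, w (Suc n)} \<in> edges H)"
    unfolding eventually_sequentially by blast
  have "w m \<in> component_of H (w N)" if "m \<ge> N" for m
    using that
  proof (induction m rule: dec_induct)
    case (step n)
    then show ?case using N[of n] by (auto intro: component_of_step)
  qed simp
  then have "has_tail_in w (component_of H (w N))" by (auto simp: has_tail_in_def)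
  then show ?thesis using N by auto
qed

lemma ray_nth: "ray H r \<Longrightarrow> r i \<in> verts H"
  by (auto simp: ray_def)

lemma has_tail_in_Suc: "has_tail_in r K \<Longrightarrow> has_tail_in (\<lambda>n. r (Suc n)) K"
  unfolding has_tail_in_def by (meson le_Suc_eq)

lemma sequence_tail_in_del_verts_component:
  assumes "\<And>i. w i \<in> verts H" "\<And>i. w (Suc i) = w i \<or> {w i, w (Suc i)} \<in> edges H"
    and "has_tail_in w (- F)"
  shows "\<exists>K\<in>graph_components (del_verts H F). has_tail_in w K"
proof (rule walk_tail_in_component)
  show "\<forall>\<^sub>F n in sequentially. w n \<in> verts (del_verts H F)"
    using assms(3) unfolding has_tail_in_iff by eventually_elim (use assms(1) in auto)
  show "\<forall>\<^sub>F n in sequentially. w (Suc n) = w n \<or> {w n, w (Suc n)} \<in> edges (del_verts H F)"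
    using assms(3) has_tail_in_Suc[OF assms(3)] unfolding has_tail_in_iff
    by eventually_elim (use assms(2) in auto)
qed

lemma ray_tail_in_del_verts_component:
  assumes "ray H r" "finite F"
  shows "\<exists>K\<in>graph_components (del_verts H F). has_tail_in r K"
  using assms by (intro sequence_tail_in_del_verts_component inj_has_tail_in_avoid) (auto simp: ray_def)

lemma ray_tail_in_del_edges_component:
  assumes "ray G r" "finite F" "F \<subseteq> edges G" "simple_graph G"
  shows "\<exists>K\<in>graph_components (del_edges G F). has_tail_in r K"
proof (rule walk_tail_in_component)
  show "\<forall>\<^sub>F n in sequentially. r n \<in> verts (del_edges G F)"
    using assms(1) by (auto simp: ray_def intro!: always_eventually)
  \<comment> \<open>A tail of \<open>r\<close> without endpoints of edges in \<open>F\<close> uses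
    no edge of \<open>F\<close>; this reduces edge deletion to avoiding a finite set of
    vertices.\<close>
  have "finite (\<Union>F)" using assms simple_graph_edge(2)[OF assms(4)] by auto
  then have "has_tail_in r (- \<Union>F)" using assms(1) by (auto simp: ray_def intro: inj_has_tail_in_avoid)
  then show "\<forall>\<^sub>F n in sequentially. r (Suc n) = r n \<or> {r n, r (Suc n)} \<in> edges (del_edges G F)"
    unfolding has_tail_in_iff by eventually_elim (use assms(1) in \<open>auto simp: ray_def\<close>)
qed

text \<open>Leaving each vertex at its last visit turns a sequence with finite fibres into a ray.\<close>

lemma ray_in_finite_fibre_sequence:
  assumes "\<And>x. finite {i. w i = x}" "\<And>i. w i \<in> verts H"
    and "\<And>i. w (Suc i) = w i \<or> {w i, w (Suc i)} \<in> edges H"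
  shows "\<exists>s. ray H s \<and> (\<forall>i. \<exists>j. {s i, s (Suc i)} = {w j, w (Suc j)})"
proof -
  define last where "last i = Max {j. w j = w i}" for i
  have w_last [simp]: "w (last i) = w i" for i
    using Max_in[of "{j. w j = w i}"] assms(1) by (auto simp: last_def)
  have le_last: "j \<le> last i" if "w j = w i" for i j
    using that assms(1) by (simp add: last_def)
  \<comment> \<open>\<open>j k\<close> is a time of last visit, so the step of \<open>w\<close> at
    that time moves to another vertex, and \<open>j (Suc k)\<close> is the last visit to that
    vertex. Consecutive vertices of \<open>w \<circ> j\<close> are therefore joined by an actual
    step of \<open>w\<close>.\<close>
  define j where "j = rec_nat (last 0) (\<lambda>_ k. last (Suc k))"
  have j_Suc: "j (Suc k) = last (Suc (j k))" for k by (simp add: j_def)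
  have last_j: "last (j k) = j k" for k
  proof -
    have "last (last i) = last i" for i by (simp add: last_def[of "last i"]) (simp add: last_def)
    then show ?thesis by (cases k) (auto simp: j_def)
  qed
  have "j k < j (Suc k)" for k
    using le_last[of "Suc (j k)" "Suc (j k)"] by (simp add: j_Suc)
  then have mono: "strict_mono j" by (simp add: strict_mono_Suc_iff)
  have "inj (w \<circ> j)"
  proof (rule linorder_injI)
    fix k l :: nat assume "k < l"
    then have "j k < j l" using mono by (simp add: strict_mono_def)
    then show "(w \<circ> j) k \<noteq> (w \<circ> j) l" using le_last[of "j l" "j k"] last_j[of k] by auto
  qed
  moreover have sj: "w (j (Suc k)) = w (Suc (j k))" for k by (simp add: j_Suc)
  moreover have "{w (j k), w (Suc (j k))} \<in> edges H" for k
    using assms(3)[of "j k"] le_last[of "Suc (j k)" "j k"] last_j[of k] by auto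
  ultimately have "ray H (w \<circ> j)" using assms(2) by (auto simp: ray_def)
  then show ?thesis using sj by (intro exI[of _ "w \<circ> j"]) auto
qed

subsection \<open>Ends\<close>

lemma successively_path_component:
  "successively (\<lambda>u v. {u, v} \<in> edges H) p \<Longrightarrow> p \<noteq> [] \<Longrightarrow> last p \<in> component_of H (hd p)"
proof (induction p rule: induct_list012)
  case (3 x y zs)
  then have "y \<in> component_of H x" "last (y # zs) \<in> component_of H y"
    by (auto intro: component_of_step[OF component_of_refl])
  then show ?case by (auto intro: component_of_trans)
qed auto

lemma component_path:
  assumes "w \<in> component_of H v" "v \<in> verts H" "simple_graph H"
  shows "\<exists>p. graph_path H p \<and> hd p = v \<and> last p = w"
proof -
  have "(v, w) \<in> {(x, y). {x, y} \<in> edges H}\<^sup>*" using assms(1) by (simp add: component_of_def)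
  then show ?thesis
  proof induction
    case base
    then show ?case using assms by (intro exI[of _ "[v]"]) (auto simp: graph_path_def)
  next
    case (step y z)
    then obtain p where p: "graph_path H p" "hd p = v" "last p = y" by blast
    have yz: "{y, z} \<in> edges H" using step by simp
    show ?case
    proof (cases "z \<in> set p")
      \<comment> \<open>The new vertex already lies on the path, which is cut off there to keep its
        vertices distinct.\<close>
      case True
      then obtain p1 p2 where "p = p1 @ z # p2" by (auto simp: in_set_conv_decomp)
      then have "graph_path H (p1 @ [z])" "hd (p1 @ [z]) = v"
        using p by (auto simp: graph_path_def successively_append_iff hd_append)
      then show ?thesis by (intro exI[of _ "p1 @ [z]"]) auto
    next
      case False
      then have "graph_path H (p @ [z])" "hd (p @ [z]) = v"
        using p yz simple_graphD(2)[OF assms(3) yz]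
        by (auto simp: graph_path_def successively_append_iff)
      then show ?thesis by (intro exI[of _ "p @ [z]"]) auto
    qed
  qed
qed

lemma graph_path_del_verts:
  "graph_path (del_verts H F) p \<longleftrightarrow> graph_path H p \<and> set p \<inter> F = {}"
proof -
  have "successively (\<lambda>u v. {u, v} \<in> edges (del_verts H F)) p \<longleftrightarrow>
      successively (\<lambda>u v. {u, v} \<in> edges H) p" if "set p \<inter> F = {}"
    using that by (intro successively_cong) auto
  then show ?thesis by (auto simp: graph_path_def)
qed

text \<open>Each path that meets \<open>X\<close> selects a point of \<open>X\<close> on it, and
  disjoint paths select different points.\<close>

lemma pairwise_disjnt_finite_meeting:
  assumes "pairwise (\<lambda>p q. disjnt (set p) (set q)) P" "finite X"
  shows "finite {p \<in> P. set p \<inter> X \<noteq> {}}"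
proof -
  define f where "f p = (SOME x. x \<in> set p \<inter> X)" for p
  have f: "f p \<in> set p \<inter> X" if "set p \<inter> X \<noteq> {}" for p
    unfolding f_def using that by (intro someI_ex[of "\<lambda>x. x \<in> set p \<inter> X"]) blast
  have "inj_on f {p \<in> P. set p \<inter> X \<noteq> {}}"
  proof (rule inj_onI)
    fix p q assume pq: "p \<in> {p \<in> P. set p \<inter> X \<noteq> {}}" "q \<in> {p \<in> P. set p \<inter> X \<noteq> {}}" "f p = f q"
    then have "f p \<in> set p \<inter> X" "f q \<in> set q \<inter> X" using f by blast+
    then show "p = q" using pq assms(1) unfolding pairwise_def disjnt_def by auto
  qed
  moreover have "f ` {p \<in> P. set p \<inter> X \<noteq> {}} \<subseteq> X" using f by auto
  ultimately show ?thesis using assms(2) by (meson finite_subset inj_on_finite)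
qed

text \<open>Only finitely many of the disjoint paths meet \<open>F\<close> or one of the two initial
  segments. Any other path joins the remaining tails without meeting \<open>F\<close>, so both tails
  lie in one component.\<close>

lemma ray_equiv_common_tail:
  assumes "(r, s) \<in> ray_equiv H" "finite F" "K \<in> graph_components (del_verts H F)" "has_tail_in r K"
  shows "has_tail_in s K"
proof -
  obtain P where P: "infinite P" "pairwise (\<lambda>p q. disjnt (set p) (set q)) P"
      "\<And>p. p \<in> P \<Longrightarrow> graph_path H p \<and> hd p \<in> range r \<and> last p \<in> range s"
    and r: "ray H r" and s: "ray H s"
    using assms(1) unfolding ray_equiv_def by blast
  obtain K' where K': "K' \<in> graph_components (del_verts H F)" "has_tail_in s K'"
    using ray_tail_in_del_verts_component[OF s assms(2)] by blast
  obtain n where n: "\<And>m. m \<ge> n \<Longrightarrow> r m \<in> K" using assms(4) by (auto simp: has_tail_in_def)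
  obtain n' where n': "\<And>m. m \<ge> n' \<Longrightarrow> s m \<in> K'" using K'(2) by (auto simp: has_tail_in_def)
  define X where "X = F \<union> r ` {..<n} \<union> s ` {..<n'}"
  have "finite X" using assms(2) by (simp add: X_def)
  then obtain p where p: "p \<in> P" "set p \<inter> X = {}"
    using pairwise_disjnt_finite_meeting[OF P(2)] P(1)
    by (metis (mono_tags, lifting) finite_subset mem_Collect_eq subsetI)
  have path: "graph_path (del_verts H F) p"
    using P(3)[OF p(1)] p(2) by (auto simp: graph_path_del_verts X_def)
  then have ne: "p \<noteq> []" by (simp add: graph_path_def)
  then have "hd p \<notin> X" "last p \<notin> X" using p(2) hd_in_set last_in_set by blast+
  then have hl: "hd p \<in> K" "last p \<in> K'"
    using P(3)[OF p(1)] n n' by (force simp: X_def)+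
  moreover have "last p \<in> component_of (del_verts H F) (hd p)"
    using path ne by (auto simp: graph_path_def intro: successively_path_component)
  ultimately have "K = K'"
    using components_eq_component_of[OF assms(3)] components_eqI[OF assms(3) K'(1)] by blast
  then show ?thesis using K' by simp
qed

text \<open>Zorn's lemma gives a maximal family of disjoint connecting paths. Were it finite,
  deleting its vertices would leave tails of both rays in a common component, and a path there could
  be added.\<close>

lemma ray_equivI:
  assumes "ray H r" "ray H s" "simple_graph H"
    and common: "\<And>F. finite F \<Longrightarrow> F \<subseteq> verts H \<Longrightarrow>
      \<exists>K\<in>graph_components (del_verts H F). has_tail_in r K \<and> has_tail_in s K"
  shows "(r, s) \<in> ray_equiv H"
proof -
  define A where "A = {P. (\<forall>p\<in>P. graph_path H p \<and> hd p \<in> range r \<and> last p \<in> range s) \<and>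
     pairwise (\<lambda>p q. disjnt (set p) (set q)) P}"
  have "\<exists>M\<in>A. \<forall>X\<in>A. M \<subseteq> X \<longrightarrow> X = M"
  proof (rule subset_Zorn')
    fix C assume C: "subset.chain A C"
    then have "pairwise (\<lambda>p q. disjnt (set p) (set q)) (\<Union>C)"
      by (intro pairwise_chain_Union)
        (auto simp: A_def subset.chain_def chain_subset_def simp del: psubsetI, blast)
    then show "\<Union>C \<in> A" using C by (auto simp: A_def subset.chain_def)
  qed
  then obtain M where M: "M \<in> A" and max: "\<And>X. X \<in> A \<Longrightarrow> M \<subseteq> X \<Longrightarrow> X = M" by blast
  have "infinite M"
  proof
    assume "finite M"
    define F where "F = (\<Union>p\<in>M. set p)"
    have "finite F" "F \<subseteq> verts H"
      using \<open>finite M\<close> M by (auto simp: F_def A_def graph_path_def)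
    from common[OF this] obtain K where K: "K \<in> graph_components (del_verts H F)"
      "has_tail_in r K" "has_tail_in s K" by blast
    obtain m n where mn: "r m \<in> K" "s n \<in> K" using K has_tail_in_meets by meson
    have "K \<subseteq> verts (del_verts H F)" by (rule components_subset_verts[OF simple_del_verts[OF assms(3)] K(1)])
    then have "r m \<in> verts (del_verts H F)" "s n \<in> component_of (del_verts H F) (r m)"
      using components_eq_component_of[OF K(1) mn(1)] mn by blast+
    then obtain p where p: "graph_path (del_verts H F) p" "hd p = r m" "last p = s n"
      using component_path[OF _ _ simple_del_verts[OF assms(3)]] by blast
    have path: "graph_path H p" and avoid: "set p \<inter> F = {}" using p(1) by (simp_all add: graph_path_del_verts)
    have "disjnt (set p) (set q) \<and> disjnt (set q) (set p)" if "q \<in> M" for q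
      using avoid that by (auto simp: F_def disjnt_def)
    then have "pairwise (\<lambda>p q. disjnt (set p) (set q)) (insert p M)"
      using M by (simp add: A_def pairwise_insert)
    then have "insert p M \<in> A" using M path p(2,3) by (simp add: A_def)
    then have "p \<in> M" using max[of "insert p M"] by auto
    then have "set p \<subseteq> F" by (auto simp: F_def)
    then have "set p \<inter> F = set p" by (rule Int_absorb2)
    then have "set p = {}" using avoid by metis
    then show False using path by (simp add: graph_path_def)
  qed
  then show ?thesis using M assms(1,2) by (auto simp: ray_equiv_def A_def)
qed

text \<open>Separation by finite vertex sets is the form in which reflexivity and symmetry are
  evident; families of paths need not be reversed.\<close>

lemma ray_equiv_iff:
  assumes "simple_graph H"
  shows "(r, s) \<in> ray_equiv H \<longleftrightarrow> ray H r \<and> ray H s \<and>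
    (\<forall>F. finite F \<longrightarrow> F \<subseteq> verts H \<longrightarrow>
      (\<exists>K\<in>graph_components (del_verts H F). has_tail_in r K \<and> has_tail_in s K))"
proof
  assume "(r, s) \<in> ray_equiv H"
  moreover from this have "ray H r" "ray H s" by (auto simp: ray_equiv_def)
  ultimately show "ray H r \<and> ray H s \<and> (\<forall>F. finite F \<longrightarrow> F \<subseteq> verts H \<longrightarrow>
      (\<exists>K\<in>graph_components (del_verts H F). has_tail_in r K \<and> has_tail_in s K))"
    using ray_equiv_common_tail ray_tail_in_del_verts_component by metis
qed (use ray_equivI assms in blast)

lemma equiv_ray_equiv:
  assumes "simple_graph H"
  shows "equiv {r. ray H r} (ray_equiv H)"
proof (rule equivI)
  show "ray_equiv H \<subseteq> {r. ray H r} \<times> {r. ray H r}" by (auto simp: ray_equiv_def)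
  show "refl_on {r. ray H r} (ray_equiv H)"
    using ray_tail_in_del_verts_component by (auto simp: refl_on_def ray_equiv_iff[OF assms])
  show "sym (ray_equiv H)"
    by (rule symI) (auto simp: ray_equiv_iff[OF assms])
  show "trans (ray_equiv H)"
  proof (rule transI)
    fix r s t assume rs: "(r, s) \<in> ray_equiv H" and st: "(s, t) \<in> ray_equiv H"
    show "(r, t) \<in> ray_equiv H"
    proof (rule ray_equivI[OF _ _ assms])
      fix F assume F: "finite F" "F \<subseteq> verts H"
      have "ray H r" using rs by (simp add: ray_equiv_def)
      then obtain K where K: "K \<in> graph_components (del_verts H F)" "has_tail_in r K"
        using ray_tail_in_del_verts_component[OF _ F(1)] by blast
      then have "has_tail_in t K"
        using ray_equiv_common_tail[OF st F(1) K(1)] ray_equiv_common_tail[OF rs F(1) K] by blast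
      then show "\<exists>K\<in>graph_components (del_verts H F). has_tail_in r K \<and> has_tail_in t K"
        using K by blast
    qed (use rs st in \<open>auto simp: ray_equiv_def\<close>)
  qed
qed

lemma ends_ray:
  assumes "simple_graph H" "\<epsilon> \<in> ends H" "r \<in> \<epsilon>"
  shows "ray H r" "\<epsilon> = ray_equiv H `` {r}"
proof -
  obtain r0 where r0: "ray H r0" "\<epsilon> = ray_equiv H `` {r0}"
    using assms(2) unfolding ends_def by (auto elim: quotientE)
  then have "(r0, r) \<in> ray_equiv H" using assms(3) by auto
  then show "ray H r" "\<epsilon> = ray_equiv H `` {r}"
    using equiv_class_eq[OF equiv_ray_equiv[OF assms(1)]] r0 by (auto simp: ray_equiv_def)
qed

lemma ends_nonempty: "simple_graph H \<Longrightarrow> \<epsilon> \<in> ends H \<Longrightarrow> \<exists>r. r \<in> \<epsilon>"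
  unfolding ends_def using in_quotient_imp_non_empty[OF equiv_ray_equiv] by blast

lemma ray_equiv_class_end: "ray H r \<Longrightarrow> ray_equiv H `` {r} \<in> ends H"
  by (auto simp: ends_def intro: quotientI)

lemma ray_in_class: "simple_graph H \<Longrightarrow> ray H r \<Longrightarrow> r \<in> ray_equiv H `` {r}"
  by (rule equiv_class_self[OF equiv_ray_equiv]) simp_all

lemma ends_eqI:
  assumes "simple_graph H" "\<epsilon> \<in> ends H" "\<eta> \<in> ends H" "r \<in> \<epsilon>" "s \<in> \<eta>" "(r, s) \<in> ray_equiv H"
  shows "\<epsilon> = \<eta>"
  using ends_ray(2)[OF assms(1,2,4)] ends_ray(2)[OF assms(1,3,5)]
    equiv_class_eq[OF equiv_ray_equiv[OF assms(1)] assms(6)] by simp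

text \<open>A single ray of the end evaluates the definite description, because equivalent rays have
  their tails in the same component.\<close>

lemma end_component_eq:
  assumes "simple_graph H" "\<epsilon> \<in> ends H" "r \<in> \<epsilon>" "finite F"
    and "K \<in> graph_components (del_verts H F)" "has_tail_in r K"
  shows "end_component H F \<epsilon> = K"
  unfolding end_component_def
proof (rule the_equality)
  have "(r, s) \<in> ray_equiv H" if "s \<in> \<epsilon>" for s
    using that ends_ray(2)[OF assms(1-3)] by auto
  then show "K \<in> graph_components (del_verts H F) \<and> (\<forall>s\<in>\<epsilon>. has_tail_in s K)"
    using ray_equiv_common_tail assms by metis
  show "K' = K" if "K' \<in> graph_components (del_verts H F) \<and> (\<forall>s\<in>\<epsilon>. has_tail_in s K')" for K'
    using that tail_component_unique assms by metis
qed

subsection \<open>Edge-directions\<close>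

text \<open>Monotonicity is weakened to nonempty intersection: after deleting more edges, a
  component lies inside every coarser component that it meets.\<close>

lemma edge_directionsI:
  assumes "\<rho> \<in> extensional (fin_edge_sets G)"
    and "\<And>F. F \<in> fin_edge_sets G \<Longrightarrow> \<rho> F \<in> graph_components (del_edges G F)"
    and "\<And>F. F \<in> fin_edge_sets G \<Longrightarrow> infinite (\<rho> F)"
    and "\<And>F F'. F \<in> fin_edge_sets G \<Longrightarrow> F' \<in> fin_edge_sets G \<Longrightarrow> F \<subseteq> F' \<Longrightarrow> \<rho> F \<inter> \<rho> F' \<noteq> {}"
  shows "\<rho> \<in> edge_directions G"
proof -
  have "\<rho> F' \<subseteq> \<rho> F" if "F \<in> fin_edge_sets G" "F' \<in> fin_edge_sets G" "F \<subseteq> F'" for F F'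
    using components_del_edges_subset[OF assms(2)[OF that(1)] assms(2)[OF that(2)] that(3)] assms(4)[OF that] .
  then show ?thesis using assms(1-3) by (auto simp: edge_directions_def PiE_def)
qed

lemma edge_directionsD:
  assumes "\<rho> \<in> edge_directions G"
  shows "F \<in> fin_edge_sets G \<Longrightarrow> \<rho> F \<in> graph_components (del_edges G F)"
    and "F \<in> fin_edge_sets G \<Longrightarrow> infinite (\<rho> F)"
    and "F \<in> fin_edge_sets G \<Longrightarrow> F' \<in> fin_edge_sets G \<Longrightarrow> F \<subseteq> F' \<Longrightarrow> \<rho> F' \<subseteq> \<rho> F"
    and "\<rho> \<in> extensional (fin_edge_sets G)"
  using assms unfolding edge_directions_def PiE_iff by auto

lemma fin_edge_sets_Un: "F \<in> fin_edge_sets G \<Longrightarrow> F' \<in> fin_edge_sets G \<Longrightarrow> F \<union> F' \<in> fin_edge_sets G"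
  by (simp add: fin_edge_sets_def)

lemma fin_edge_sets_empty [simp]: "{} \<in> fin_edge_sets G"
  by (simp add: fin_edge_sets_def)

lemma edge_directions_Un:
  assumes "\<rho> \<in> edge_directions G" "F \<in> fin_edge_sets G" "F' \<in> fin_edge_sets G"
  shows "\<rho> (F \<union> F') \<subseteq> \<rho> F \<inter> \<rho> F'"
  using edge_directionsD(3)[OF assms(1)] assms fin_edge_sets_Un by (metis Int_subset_iff Un_upper1 Un_upper2)

lemma edge_directions_meet:
  assumes "\<rho> \<in> edge_directions G" "F \<in> fin_edge_sets G" "F' \<in> fin_edge_sets G"
  shows "\<rho> F \<inter> \<rho> F' \<noteq> {}"
  using edge_directions_Un[OF assms] edge_directionsD(2)[OF assms(1) fin_edge_sets_Un[OF assms(2,3)]]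
  by (metis finite.emptyI subset_empty)

lemma edge_directions_eqI:
  assumes "\<rho> \<in> edge_directions G" "\<rho>' \<in> edge_directions G"
    and "\<And>F. F \<in> fin_edge_sets G \<Longrightarrow> \<exists>x. x \<in> \<rho> F \<and> x \<in> \<rho>' F"
  shows "\<rho> = \<rho>'"
proof (rule extensionalityI[OF edge_directionsD(4)[OF assms(1)] edge_directionsD(4)[OF assms(2)]])
  fix F assume F: "F \<in> fin_edge_sets G"
  obtain x where "x \<in> \<rho> F" "x \<in> \<rho>' F" using assms(3)[OF F] by blast
  then show "\<rho> F = \<rho>' F"
    using components_eqI[OF edge_directionsD(1)[OF assms(1) F] edge_directionsD(1)[OF assms(2) F]] by blast
qed

subsection \<open>Ends of the line graph\<close>

text \<open>The edge set by which \<open>end_to_direction\<close> matches components of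
  \<open>G\<close> with components of the line graph. It is empty for an isolated vertex, so it
  determines a component only when it is nonempty.\<close>

definition edges_within :: "'a graph \<Rightarrow> 'a set \<Rightarrow> 'a set set" where
  "edges_within G K = {e \<in> edges G. e \<subseteq> K}"

text \<open>Deleting \<open>F\<close> as edges of \<open>G\<close> or as vertices of the line graph
  has the same effect on connectivity: incident edges share a vertex of one component, and a step
  along a surviving edge passes between edges incident with it.\<close>

lemma line_graph_component_of:
  assumes "simple_graph G" "e \<in> edges G - F" "x \<in> e"
  shows "component_of (del_verts (line_graph G) F) e =
    edges_within (del_edges G F) (component_of (del_edges G F) x)" (is "?C = edges_within ?G ?K")
proof
  have within: "f \<subseteq> ?K" if "f \<in> edges G - F" "y \<in> f" "y \<in> ?K" for f y
  proof -
    obtain a b where "f = {a, b}" using simple_graph_edgeE[OF assms(1)] \<open>f \<in> edges G - F\<close> by blast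
    then show ?thesis using that component_of_step[of _ ?G x]
      by (auto simp: insert_commute)
  qed
  show "?C \<subseteq> edges_within ?G ?K"
  proof (rule component_of_least)
    show "e \<in> edges_within ?G ?K"
      using assms within[OF assms(2,3)] by (simp add: edges_within_def)
    fix f g assume f: "f \<in> edges_within ?G ?K" and fg: "{f, g} \<in> edges (del_verts (line_graph G) F)"
    then have "g \<in> edges G - F" "f \<inter> g \<noteq> {}"
      by (auto simp: edges_line_graph_iff)
    moreover from this obtain y where "y \<in> f" "y \<in> g" by blast
    ultimately show "g \<in> edges_within ?G ?K"
      using within[of g y] f by (auto simp: edges_within_def)
  qed
  have adj: "g \<in> ?C" if "f \<in> ?C" "f \<in> edges G - F" "g \<in> edges G - F" "z \<in> f" "z \<in> g" for f g z
  proof (cases "f = g")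
    case False
    then have "{f, g} \<in> edges (del_verts (line_graph G) F)"
      using that by (auto simp: edges_line_graph_iff)
    then show ?thesis using component_of_step that(1) by metis
  qed (use that in simp)
  \<comment> \<open>The invariant carried along a walk in \<open>G\<close>: every surviving edge at
    the current vertex lies in the component of \<open>e\<close>.\<close>
  have "?K \<subseteq> {y. \<forall>f\<in>edges G - F. y \<in> f \<longrightarrow> f \<in> ?C}"
  proof (rule component_of_least)
    show "x \<in> {y. \<forall>f\<in>edges G - F. y \<in> f \<longrightarrow> f \<in> ?C}"
      using adj[OF component_of_refl assms(2)] assms(3) by blast
    fix y z assume y: "y \<in> {y. \<forall>f\<in>edges G - F. y \<in> f \<longrightarrow> f \<in> ?C}" and yz: "{y, z} \<in> edges ?G"
    then have "{y, z} \<in> ?C" "{y, z} \<in> edges G - F" by auto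
    then show "z \<in> {y. \<forall>f\<in>edges G - F. y \<in> f \<longrightarrow> f \<in> ?C}" using adj[of "{y, z}" _ z] by blast
  qed
  moreover have "f \<noteq> {}" if "f \<in> edges G" for f using simple_graph_edge(1)[OF assms(1) that] .
  ultimately show "edges_within ?G ?K \<subseteq> ?C" by (fastforce simp: edges_within_def)
qed

lemma line_graph_component:
  assumes "simple_graph G" "K \<in> graph_components (del_edges G F)" "e \<in> edges_within (del_edges G F) K"
  shows "edges_within (del_edges G F) K = component_of (del_verts (line_graph G) F) e"
    and "edges_within (del_edges G F) K \<in> graph_components (del_verts (line_graph G) F)"
proof -
  have e: "e \<in> edges G - F" "e \<subseteq> K" using assms(3) by (auto simp: edges_within_def)
  obtain x where x: "x \<in> e" using simple_graph_edge(1)[OF assms(1)] e by blast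
  then have "K = component_of (del_edges G F) x" using components_eq_component_of[OF assms(2)] e by blast
  then show eq: "edges_within (del_edges G F) K = component_of (del_verts (line_graph G) F) e"
    using line_graph_component_of[OF assms(1) e(1) x] by simp
  show "edges_within (del_edges G F) K \<in> graph_components (del_verts (line_graph G) F)"
    unfolding eq using e by simp
qed

lemma line_graph_component_cases:
  assumes "simple_graph G" "C \<in> graph_components (del_verts (line_graph G) F)"
  obtains K e where "K \<in> graph_components (del_edges G F)" "C = edges_within (del_edges G F) K" "e \<in> C"
proof -
  obtain e where e: "e \<in> edges G - F" "C = component_of (del_verts (line_graph G) F) e"
    using assms(2) by (auto simp: graph_components_def)
  obtain x where x: "x \<in> e" "x \<in> verts G"
    using simple_graph_edgeE[OF assms(1), of e] e(1) by blast
  show ?thesis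
  proof (rule that)
    show "component_of (del_edges G F) x \<in> graph_components (del_edges G F)" using x by simp
    show "C = edges_within (del_edges G F) (component_of (del_edges G F) x)"
      unfolding e(2) by (rule line_graph_component_of[OF assms(1) e(1) x(1)])
    show "e \<in> C" unfolding e(2) by simp
  qed
qed

text \<open>An injective sequence of edges leaves the finite set \<open>F\<close>, so on its tail
  \<open>Pow K\<close> and the surviving edges inside \<open>K\<close> agree. Tails of line graph
  rays are located by \<open>Pow K\<close> from here on.\<close>

lemma line_ray_tail_within_iff:
  assumes "ray (line_graph G) r" "finite F"
  shows "has_tail_in r (edges_within (del_edges G F) K) \<longleftrightarrow> has_tail_in r (Pow K)"
proof
  assume "has_tail_in r (Pow K)"
  moreover have "has_tail_in r (- F)" using assms by (simp add: ray_def inj_has_tail_in_avoid)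
  moreover have "has_tail_in r (edges G)" using ray_nth[OF assms(1)] by (auto simp: has_tail_in_def)
  ultimately have "has_tail_in r (Pow K \<inter> (- F \<inter> edges G))" by (intro has_tail_in_Int)
  then show "has_tail_in r (edges_within (del_edges G F) K)"
    by (rule has_tail_in_mono) (auto simp: edges_within_def)
qed (auto elim: has_tail_in_mono simp: edges_within_def)

lemma line_ray_tail:
  assumes "simple_graph G" "ray (line_graph G) r" "finite F"
  shows "\<exists>K\<in>graph_components (del_edges G F). has_tail_in r (Pow K)"
proof -
  obtain C where C: "C \<in> graph_components (del_verts (line_graph G) F)" "has_tail_in r C"
    using ray_tail_in_del_verts_component[OF assms(2,3)] by blast
  then show ?thesis
    using line_graph_component_cases[OF assms(1) C(1)] line_ray_tail_within_iff[OF assms(2,3)] by metis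
qed

lemma edge_tail_component_unique:
  assumes "simple_graph G" "\<And>i. r i \<in> edges G"
    and "K \<in> graph_components H" "K' \<in> graph_components H" "has_tail_in r (Pow K)" "has_tail_in r (Pow K')"
  shows "K = K'"
proof -
  obtain m where "r m \<subseteq> K" "r m \<subseteq> K'" using has_tail_in_both[OF assms(5,6)] by blast
  moreover obtain x where "x \<in> r m" using simple_graph_edge(1)[OF assms(1,2)] by blast
  ultimately show ?thesis using components_eqI[OF assms(3,4)] by blast
qed

lemma edges_within_tail_component:
  assumes "simple_graph G" "ray (line_graph G) r" "finite F"
    and "K \<in> graph_components (del_edges G F)" "has_tail_in r (Pow K)"
  shows "edges_within (del_edges G F) K \<in> graph_components (del_verts (line_graph G) F)"
    and "has_tail_in r (edges_within (del_edges G F) K)"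
proof -
  show tail: "has_tail_in r (edges_within (del_edges G F) K)"
    using line_ray_tail_within_iff assms by blast
  then obtain m where "r m \<in> edges_within (del_edges G F) K" using has_tail_in_meets by blast
  then show "edges_within (del_edges G F) K \<in> graph_components (del_verts (line_graph G) F)"
    using line_graph_component(2)[OF assms(1,4)] by blast
qed

lemma line_ray_equivI:
  assumes "simple_graph G" "ray (line_graph G) r" "ray (line_graph G) s"
    and "\<And>F. F \<in> fin_edge_sets G \<Longrightarrow>
      \<exists>K\<in>graph_components (del_edges G F). has_tail_in r (Pow K) \<and> has_tail_in s (Pow K)"
  shows "(r, s) \<in> ray_equiv (line_graph G)"
proof (rule ray_equivI[OF assms(2,3) simple_line_graph])
  fix F assume F: "finite F" "F \<subseteq> verts (line_graph G)"
  then obtain K where K: "K \<in> graph_components (del_edges G F)" "has_tail_in r (Pow K)" "has_tail_in s (Pow K)"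
    using assms(4)[of F] by (auto simp: fin_edge_sets_def)
  then show "\<exists>K\<in>graph_components (del_verts (line_graph G) F). has_tail_in r K \<and> has_tail_in s K"
    using edges_within_tail_component[OF assms(1) _ F(1) K(1)] assms(2,3) by blast
qed

lemma end_to_direction_eq:
  assumes "simple_graph G" "\<epsilon> \<in> ends (line_graph G)" "r \<in> \<epsilon>" "F \<in> fin_edge_sets G"
    and "K \<in> graph_components (del_edges G F)" "has_tail_in r (Pow K)"
  shows "end_to_direction G \<epsilon> F = K"
    and "end_component (line_graph G) F \<epsilon> = edges_within (del_edges G F) K"
proof -
  have F: "finite F" using assms(4) by (simp add: fin_edge_sets_def)
  have r: "ray (line_graph G) r" using ends_ray(1)[OF simple_line_graph assms(2,3)] .
  show ec: "end_component (line_graph G) F \<epsilon> = edges_within (del_edges G F) K"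
    using edges_within_tail_component[OF assms(1) r F assms(5,6)]
    by (intro end_component_eq[OF simple_line_graph assms(2,3) F])
  have "(THE K. K \<in> graph_components (del_edges G F) \<and>
        edges_within (del_edges G F) K = end_component (line_graph G) F \<epsilon>) = K"
  proof (rule the_equality)
    \<comment> \<open>Equal edge sets put the tail of \<open>r\<close> into \<open>K'\<close> as
      well, and an edge of that tail supplies a vertex common to \<open>K\<close> and
      \<open>K'\<close>.\<close>
    fix K' assume K': "K' \<in> graph_components (del_edges G F) \<and>
        edges_within (del_edges G F) K' = end_component (line_graph G) F \<epsilon>"
    then have "has_tail_in r (Pow K')"
      using line_ray_tail_within_iff[OF r F] assms(6) ec by metis
    then show "K' = K"
      using edge_tail_component_unique[OF assms(1) _ conjunct1[OF K'] assms(5) _ assms(6)] ray_nth[OF r]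
      by simp
  qed (use assms(5) ec in simp)
  then show "end_to_direction G \<epsilon> F = K"
    using assms(4) by (simp add: end_to_direction_def edges_within_def)
qed

lemma end_to_direction_component:
  assumes "simple_graph G" "\<epsilon> \<in> ends (line_graph G)" "r \<in> \<epsilon>" "F \<in> fin_edge_sets G"
  shows "end_to_direction G \<epsilon> F \<in> graph_components (del_edges G F)"
    and "has_tail_in r (Pow (end_to_direction G \<epsilon> F))"
proof -
  have "finite F" using assms(4) by (simp add: fin_edge_sets_def)
  with line_ray_tail[OF assms(1) ends_ray(1)[OF simple_line_graph assms(2,3)]]
  obtain K where "K \<in> graph_components (del_edges G F)" "has_tail_in r (Pow K)" by blast
  with end_to_direction_eq(1)[OF assms]
  show "end_to_direction G \<epsilon> F \<in> graph_components (del_edges G F)"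
    "has_tail_in r (Pow (end_to_direction G \<epsilon> F))" by auto
qed

lemma end_component_line_graph:
  assumes "simple_graph G" "\<epsilon> \<in> ends (line_graph G)" "F \<in> fin_edge_sets G"
  shows "end_component (line_graph G) F \<epsilon> = edges_within (del_edges G F) (end_to_direction G \<epsilon> F)"
  using ends_nonempty[OF simple_line_graph assms(2)]
    end_to_direction_eq(2)[OF assms(1,2) _ assms(3)] end_to_direction_component[OF assms(1,2) _ assms(3)]
  by blast

lemma end_to_direction_in:
  assumes "simple_graph G" "\<epsilon> \<in> ends (line_graph G)"
  shows "end_to_direction G \<epsilon> \<in> edge_directions G"
proof (rule edge_directionsI)
  obtain r where r: "r \<in> \<epsilon>" using ends_nonempty[OF simple_line_graph assms(2)] by blast
  have ray: "ray (line_graph G) r" using ends_ray(1)[OF simple_line_graph assms(2) r] .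
  note tail = end_to_direction_component[OF assms r]
  show "end_to_direction G \<epsilon> F \<in> graph_components (del_edges G F)" if "F \<in> fin_edge_sets G" for F
    using tail(1)[OF that] .
  \<comment> \<open>The injective tail makes \<open>Pow\<close> of the component infinite, which
    forces the component itself to be infinite.\<close>
  show "infinite (end_to_direction G \<epsilon> F)" if "F \<in> fin_edge_sets G" for F
    using inj_tail_infinite[OF _ tail(2)[OF that]] ray by (auto simp: ray_def)
  show "end_to_direction G \<epsilon> F \<inter> end_to_direction G \<epsilon> F' \<noteq> {}"
    if F: "F \<in> fin_edge_sets G" "F' \<in> fin_edge_sets G" for F F'
  proof -
    obtain m where m: "r m \<subseteq> end_to_direction G \<epsilon> F" "r m \<subseteq> end_to_direction G \<epsilon> F'"
      using has_tail_in_both[OF tail(2)[OF F(1)] tail(2)[OF F(2)]] by blast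
    moreover have "r m \<noteq> {}" using simple_graph_edge(1)[OF assms(1)] ray by (auto simp: ray_def)
    ultimately show ?thesis by blast
  qed
qed (simp add: end_to_direction_def)

lemma end_to_direction_eqI:
  assumes "simple_graph G" "\<epsilon> \<in> ends (line_graph G)" "r \<in> \<epsilon>" "\<rho> \<in> edge_directions G"
    and "\<And>F. F \<in> fin_edge_sets G \<Longrightarrow> has_tail_in r (Pow (\<rho> F))"
  shows "end_to_direction G \<epsilon> = \<rho>"
proof (rule extensionalityI[OF _ edge_directionsD(4)[OF assms(4)]])
  show "end_to_direction G \<epsilon> F = \<rho> F" if "F \<in> fin_edge_sets G" for F
    using end_to_direction_eq(1)[OF assms(1-3) that edge_directionsD(1)[OF assms(4) that] assms(5)[OF that]] .
qed (simp add: end_to_direction_def)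

lemma inj_end_to_direction:
  assumes "simple_graph G"
  shows "inj_on (end_to_direction G) (ends (line_graph G))"
proof (rule inj_onI)
  fix \<epsilon> \<eta> assume e: "\<epsilon> \<in> ends (line_graph G)" "\<eta> \<in> ends (line_graph G)"
    and eq: "end_to_direction G \<epsilon> = end_to_direction G \<eta>"
  obtain r s where rs: "r \<in> \<epsilon>" "s \<in> \<eta>" using ends_nonempty[OF simple_line_graph] e by meson
  have "(r, s) \<in> ray_equiv (line_graph G)"
  proof (rule line_ray_equivI[OF assms])
    show "\<exists>K\<in>graph_components (del_edges G F). has_tail_in r (Pow K) \<and> has_tail_in s (Pow K)"
      if "F \<in> fin_edge_sets G" for F
      using end_to_direction_component[OF assms e(1) rs(1) that] eq
        end_to_direction_component(2)[OF assms e(2) rs(2) that] by auto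
  qed (use ends_ray(1)[OF simple_line_graph] e rs in blast)+
  then show "\<epsilon> = \<eta>" using ends_eqI[OF simple_line_graph e rs] by blast
qed

lemma ray_edge_ray:
  assumes "simple_graph G" "ray G r"
  shows "ray (line_graph G) (\<lambda>n. {r n, r (Suc n)})"
proof -
  have inj: "inj r" and e: "{r n, r (Suc n)} \<in> edges G" for n using assms(2) by (auto simp: ray_def)
  have ne: "{r m, r (Suc m)} \<noteq> {r n, r (Suc n)}" if "m < n" for m n
  proof -
    have "r m \<noteq> r n" "r m \<noteq> r (Suc n)" using that injD[OF inj] by fastforce+
    then show ?thesis by blast
  qed
  then have "inj (\<lambda>n. {r n, r (Suc n)})" by (rule linorder_injI)
  then show ?thesis using ne[OF lessI] e by (auto simp: ray_def edges_line_graph_iff)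
qed

lemma end_of_line_ray:
  assumes "simple_graph G" "ray (line_graph G) s" "\<rho> \<in> edge_directions G"
    and "\<And>F. F \<in> fin_edge_sets G \<Longrightarrow> has_tail_in s (Pow (\<rho> F))"
  shows "ray_equiv (line_graph G) `` {s} \<in> ends (line_graph G)"
    and "end_to_direction G (ray_equiv (line_graph G) `` {s}) = \<rho>"
proof -
  show e: "ray_equiv (line_graph G) `` {s} \<in> ends (line_graph G)"
    using ray_equiv_class_end[OF assms(2)] .
  show "end_to_direction G (ray_equiv (line_graph G) `` {s}) = \<rho>"
    using end_to_direction_eqI[OF assms(1) e ray_in_class[OF simple_line_graph assms(2)] assms(3,4)] .
qed

section \<open>Every edge-direction comes from an end of the line graph\<close>

text \<open>If \<open>v\<close> had finite degree, deleting its edges would isolate it, while the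
  values of a direction are infinite components.\<close>

lemma always_in_direction_infinite_degree:
  assumes "simple_graph G" "\<rho> \<in> edge_directions G"
    and "\<And>F. F \<in> fin_edge_sets G \<Longrightarrow> v \<in> \<rho> F"
  shows "infinite_degree G v"
proof -
  have v: "v \<in> verts G"
    using assms(3)[OF fin_edge_sets_empty]
      components_subset_verts[OF simple_del_edges[OF assms(1)] edge_directionsD(1)[OF assms(2) fin_edge_sets_empty]]
    by auto
  have "infinite {e \<in> edges G. v \<in> e}"
  proof
    assume fin: "finite {e \<in> edges G. v \<in> e}"
    define F where "F = {e \<in> edges G. v \<in> e}"
    have F: "F \<in> fin_edge_sets G" using fin by (simp add: F_def fin_edge_sets_def)
    have "component_of (del_edges G F) v \<subseteq> {v}"
      by (rule component_of_least) (auto simp: F_def)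
    moreover have "\<rho> F = component_of (del_edges G F) v"
      using components_eq_component_of[OF edge_directionsD(1)[OF assms(2) F] assms(3)[OF F]] .
    ultimately show False using edge_directionsD(2)[OF assms(2) F] finite_subset by fastforce
  qed
  then show ?thesis using v by (simp add: infinite_degree_def)
qed

text \<open>Distinct edges at \<open>v\<close> are adjacent in the line graph, so an injective
  sequence of them is a ray. Once it has left \<open>F\<close>, its edges join \<open>v\<close> to
  vertices of \<open>\<rho> F\<close>.\<close>

lemma direction_end_at_vertex:
  assumes "simple_graph G" "\<rho> \<in> edge_directions G"
    and "\<And>F. F \<in> fin_edge_sets G \<Longrightarrow> v \<in> \<rho> F"
  shows "\<rho> \<in> end_to_direction G ` ends (line_graph G)"
proof -
  have "infinite {e \<in> edges G. v \<in> e}"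
    using always_in_direction_infinite_degree[OF assms] by (simp add: infinite_degree_def)
  then obtain s :: "nat \<Rightarrow> 'a set" where s: "inj s" "range s \<subseteq> {e \<in> edges G. v \<in> e}"
    using infinite_countable_subset by blast
  then have s_in: "s n \<in> edges G" "v \<in> s n" for n by auto
  moreover have "s n \<noteq> s (Suc n)" for n using injD[OF s(1), of n "Suc n"] by auto
  moreover have "s n \<inter> s (Suc n) \<noteq> {}" for n using s_in(2) by blast
  ultimately have ray: "ray (line_graph G) s"
    using s(1) by (auto simp: ray_def edges_line_graph_iff)
  have "has_tail_in s (Pow (\<rho> F))" if F: "F \<in> fin_edge_sets G" for F
  proof (rule has_tail_in_mono)
    have "has_tail_in s (- F)"
      using inj_has_tail_in_avoid[OF s(1)] F by (simp add: fin_edge_sets_def)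
    then show "has_tail_in s (- F \<inter> range s)"
      by (auto simp: has_tail_in_def)
    show "- F \<inter> range s \<subseteq> Pow (\<rho> F)"
    proof clarify
      fix n x assume n: "s n \<notin> F" and x: "x \<in> s n"
      obtain a b where ab: "s n = {a, b}" using simple_graph_edgeE[OF assms(1) s_in(1)] by metis
      then have "{v, x} \<in> edges (del_edges G F) \<or> x = v"
        using s_in[of n] n x by (auto simp: insert_commute)
      then show "x \<in> \<rho> F"
        using components_step[OF edge_directionsD(1)[OF assms(2) F] assms(3)[OF F]] assms(3)[OF F] by blast
    qed
  qed
  then show ?thesis using end_of_line_ray[OF assms(1) ray assms(2)] by blast
qed

text \<open>The level of a vertex \<open>x\<close> of \<open>K 0\<close> is the last \<open>n\<close> with \<open>x \<in> K n\<close>. Walking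
  from level \<open>n\<close> towards \<open>K (Suc n)\<close> inside \<open>K n\<close> either raises the level or decreases the
  distance to \<open>K (Suc n)\<close> at the same level; hence no vertex is visited twice and the level
  tends to infinity.\<close>

lemma ray_through_nested_components:
  fixes K :: "nat \<Rightarrow> 'a set"
  assumes "simple_graph G"
    and comp: "\<And>n. K n \<in> graph_components (del_edges G (F n))"
    and dec: "\<And>n. K (Suc n) \<subseteq> K n" and empty: "(\<Inter>n. K n) = {}"
  shows "\<exists>r. ray G r \<and> (\<forall>n. has_tail_in r (K n))"
proof -
  have anti: "K n \<subseteq> K m" if "m \<le> n" for m n
    using dec that by (rule lift_Suc_antimono_le)
  define R where "R n = {(x, y). {x, y} \<in> edges (del_edges G (F n))}" for n
  define lev where "lev x = (LEAST n. x \<notin> K (Suc n))" for x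
  define d where "d x = (LEAST k. \<exists>t\<in>K (Suc (lev x)). (x, t) \<in> R (lev x) ^^ k)" for x
  have lev1: "x \<notin> K (Suc (lev x))" if "x \<in> K 0" for x
  proof -
    obtain n where "x \<notin> K n" using empty by blast
    then have "x \<notin> K (Suc n)" using dec by blast
    then show ?thesis unfolding lev_def by (rule LeastI)
  qed
  have lev2: "x \<in> K (lev x)" if "x \<in> K 0" for x
  proof (cases "lev x")
    case (Suc n)
    then have "n < lev x" by simp
    then show ?thesis using not_less_Least[of n "\<lambda>n. x \<notin> K (Suc n)"] Suc by (auto simp: lev_def)
  qed (use that in simp)
  have lev3: "x \<in> K n \<longleftrightarrow> n \<le> lev x" if "x \<in> K 0" for x n
  proof
    show "n \<le> lev x" if "x \<in> K n"
      using lev1[OF \<open>x \<in> K 0\<close>] that anti[of "Suc (lev x)" n] by (metis not_less_eq_eq subsetD)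
    show "x \<in> K n" if "n \<le> lev x" using lev2[OF \<open>x \<in> K 0\<close>] anti[OF that] by blast
  qed
  define better where "better x y \<longleftrightarrow> lev x < lev y \<or> lev x = lev y \<and> d y < d x" for x y
  have step: "\<exists>y. y \<in> K 0 \<and> {x, y} \<in> edges G \<and> better x y" if x: "x \<in> K 0" for x
  proof -
    define n where "n = lev x"
    obtain t where t: "t \<in> K (Suc n)" using components_nonempty[OF comp] by blast
    have "K n = component_of (del_edges G (F n)) x"
      using components_eq_component_of[OF comp] lev2[OF x] by (simp add: n_def)
    then have "(x, t) \<in> (R n)\<^sup>*" using t dec[of n] by (auto simp: component_of_def R_def)
    then have "\<exists>k. \<exists>t\<in>K (Suc n). (x, t) \<in> R n ^^ k" using t rtrancl_imp_relpow by blast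
    then have "\<exists>t\<in>K (Suc n). (x, t) \<in> R n ^^ d x" unfolding d_def n_def by (rule LeastI_ex)
    then obtain t where t: "t \<in> K (Suc n)" "(x, t) \<in> R n ^^ d x" by blast
    \<comment> \<open>\<open>x\<close> is not in \<open>K (Suc n)\<close>, so the shortest walk has
      a first step; from its end \<open>y\<close> a walk of length \<open>k\<close> remains.\<close>
    then have "d x \<noteq> 0" using lev1[OF x] n_def by (metis relpow_0_E)
    then obtain k where k: "d x = Suc k" using not0_implies_Suc by blast
    then obtain y where y: "(x, y) \<in> R n" "(y, t) \<in> R n ^^ k"
      using t(2) relpow_Suc_D2 by metis
    have "y \<in> K n" using components_step[OF comp lev2[OF x]] y(1) by (simp add: n_def R_def)
    then have y0: "y \<in> K 0" using anti[of 0 n] by blast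
    have "better x y"
    proof (cases "lev x < lev y")
      case False
      then have "lev y = n" using \<open>y \<in> K n\<close> lev3[OF y0] by (simp add: n_def)
      moreover from this have "d y \<le> k" unfolding d_def using t(1) y(2) by (intro Least_le) auto
      ultimately show ?thesis using k by (simp add: better_def n_def)
    qed (simp add: better_def)
    then show ?thesis using y(1) y0 by (auto simp: R_def)
  qed
  obtain x0 where "x0 \<in> K 0" using components_nonempty[OF comp] by blast
  then have "\<exists>r. \<forall>n. r n \<in> K 0 \<and> ({r n, r (Suc n)} \<in> edges G \<and> better (r n) (r (Suc n)))"
    using step by (intro dependent_nat_choice) auto
  then obtain r where r: "\<And>n. r n \<in> K 0" "\<And>n. {r n, r (Suc n)} \<in> edges G"
    "\<And>n. better (r n) (r (Suc n))" by blast
  have better_trans: "better x z" if "better x y" "better y z" for x y z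
    using that by (auto simp: better_def)
  have better: "better (r m) (r n)" if "m < n" for m n
    using that by (induction n) (use r(3) better_trans in \<open>auto simp: less_Suc_eq\<close>)
  have "inj r"
  proof (rule linorder_injI)
    show "r m \<noteq> r n" if "m < n" for m n using better[OF that] by (auto simp: better_def)
  qed
  then have ray: "ray G r"
    using r(2) simple_graphD(1)[OF assms(1)] by (auto simp: ray_def)
  have mono: "lev (r m) \<le> lev (r n)" if "m \<le> n" for m n
    using better[of m n] that by (cases "m = n") (auto simp: better_def)
  have "\<exists>m. n \<le> lev (r m)" for n
  proof (rule ccontr)
    assume "\<nexists>m. n \<le> lev (r m)"
    then have less: "lev (r m) < n" for m by (auto simp: not_le)
    \<comment> \<open>A bounded level gives an infinite lexicographic descent. The bound
      \<open>n\<close> keeps the truncated difference strictly decreasing whenever the level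
      rises.\<close>
    have "(r (Suc m), r m) \<in> measures [\<lambda>x. n - lev x, d]" for m
      using r(3)[of m] less[of m] less[of "Suc m"] by (auto simp: better_def)
    then show False using wf_measures[of "[\<lambda>x. n - lev x, d]"] unfolding wf_iff_no_infinite_down_chain by blast
  qed
  then have "has_tail_in r (K n)" for n
    using mono lev3[OF r(1)] unfolding has_tail_in_def by (meson order_trans)
  then show ?thesis using ray by blast
qed

text \<open>A compactness statement, as values at a union of edge sets lie in both values.
  Contrapositively, if every \<open>\<rho> F\<close> meets the finite set \<open>W\<close>, one
  vertex of \<open>W\<close> lies in all of them; both readings are used.\<close>

lemma direction_avoids_finite:
  assumes "\<rho> \<in> edge_directions G" "finite W"
    and "\<And>v. v \<in> W \<Longrightarrow> \<exists>F\<in>fin_edge_sets G. v \<notin> \<rho> F"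
  shows "\<exists>F\<in>fin_edge_sets G. \<rho> F \<inter> W = {}"
  using assms(2,3)
proof induction
  case (insert v W)
  then obtain F F' where F: "F \<in> fin_edge_sets G" "\<rho> F \<inter> W = {}" "F' \<in> fin_edge_sets G" "v \<notin> \<rho> F'"
    by blast
  have "\<rho> (F \<union> F') \<inter> insert v W = {}"
    using edge_directions_Un[OF assms(1) F(1,3)] F(2,4) by blast
  then show ?case using fin_edge_sets_Un[OF F(1,3)] by blast
qed (auto intro: fin_edge_sets_empty)

text \<open>Finite edge sets are chosen so that each component avoids the endpoints of the edges
  deleted before; the intersection of the components is then closed under adjacency, hence empty.\<close>

lemma direction_nested_components:
  assumes "simple_graph G" "connected_graph G" "\<rho> \<in> edge_directions G"
    and ex: "\<And>v. \<exists>F\<in>fin_edge_sets G. v \<notin> \<rho> F"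
  shows "\<exists>F. (\<forall>n. F n \<in> fin_edge_sets G \<and> F n \<subseteq> F (Suc n)) \<and> (\<Inter>n. \<rho> (F n)) = {}"
proof -
  have step: "\<exists>F'. F' \<in> fin_edge_sets G \<and> (F \<subseteq> F' \<and> \<rho> F' \<inter> \<Union>F = {})" if F: "F \<in> fin_edge_sets G" for F
  proof -
    have "finite (\<Union>F)"
      using F simple_graph_edge(2)[OF assms(1)] by (auto simp: fin_edge_sets_def)
    then obtain F' where F': "F' \<in> fin_edge_sets G" "\<rho> F' \<inter> \<Union>F = {}"
      using direction_avoids_finite[OF assms(3) _ ex] by blast
    then show ?thesis
      using edge_directions_Un[OF assms(3) F F'(1)] fin_edge_sets_Un[OF F F'(1)]
      by (intro exI[of _ "F \<union> F'"]) blast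
  qed
  \<comment> \<open>\<open>v0\<close> is kept outside all chosen components: a nonempty intersection
    closed under adjacency would be all of \<open>G\<close> and contain it.\<close>
  obtain v0 where v0: "v0 \<in> verts G"
    using edge_directionsD(1)[OF assms(3) fin_edge_sets_empty] by (auto simp: graph_components_def)
  obtain F0 where F0: "F0 \<in> fin_edge_sets G" "v0 \<notin> \<rho> F0" using ex by blast
  have "\<exists>F. \<forall>n. (F n \<in> fin_edge_sets G \<and> v0 \<notin> \<rho> (F n)) \<and> (F n \<subseteq> F (Suc n) \<and> \<rho> (F (Suc n)) \<inter> \<Union>(F n) = {})"
  proof (rule dependent_nat_choice)
    fix F assume F: "F \<in> fin_edge_sets G \<and> v0 \<notin> \<rho> F"
    obtain F' where F': "F' \<in> fin_edge_sets G" "F \<subseteq> F'" "\<rho> F' \<inter> \<Union>F = {}" using step F by blast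
    moreover have "v0 \<notin> \<rho> F'" using F edge_directionsD(3)[OF assms(3) _ F'(1,2)] by blast
    ultimately show "\<exists>F'. (F' \<in> fin_edge_sets G \<and> v0 \<notin> \<rho> F') \<and> (F \<subseteq> F' \<and> \<rho> F' \<inter> \<Union>F = {})" by blast
  qed (use F0 in blast)
  then obtain F where F: "\<And>n. F n \<in> fin_edge_sets G" "\<And>n. v0 \<notin> \<rho> (F n)" "\<And>n. F n \<subseteq> F (Suc n)"
    "\<And>n. \<rho> (F (Suc n)) \<inter> \<Union>(F n) = {}" by blast
  have "(\<Inter>n. \<rho> (F n)) = {}"
  proof (rule ccontr)
    assume "(\<Inter>n. \<rho> (F n)) \<noteq> {}"
    then obtain x where x: "x \<in> (\<Inter>n. \<rho> (F n))" by blast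
    have "component_of G x \<subseteq> (\<Inter>n. \<rho> (F n))"
    proof (rule component_of_least[OF x], rule INT_I)
      fix y z n assume y: "y \<in> (\<Inter>n. \<rho> (F n))" and yz: "{y, z} \<in> edges G"
      have "y \<in> \<rho> (F n)" "y \<in> \<rho> (F (Suc n))" using y by blast+
      then have "{y, z} \<in> edges (del_edges G (F n))" using yz F(4)[of n] by auto
      then show "z \<in> \<rho> (F n)"
        using components_step[OF edge_directionsD(1)[OF assms(3) F(1)] \<open>y \<in> \<rho> (F n)\<close>] by blast
    qed
    moreover have "x \<in> verts G"
      using x components_subset_verts[OF simple_del_edges[OF assms(1)] edge_directionsD(1)[OF assms(3) F(1)]] by fastforce
    ultimately show False using F(2) v0 assms(2) by (auto simp: connected_graph_def)
  qed
  then show ?thesis using F by blast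
qed

text \<open>The sets \<open>F n\<close> need not be cofinal among the finite edge sets, of which
  there may be uncountably many. Empty intersection is enough: given \<open>E\<close>, some
  \<open>\<rho> (F n)\<close> contains no endpoint of an edge in \<open>E\<close>, so it stays
  connected when \<open>E\<close> is deleted and, meeting \<open>\<rho> E\<close>, lies inside
  it.\<close>

lemma direction_end_of_ray:
  assumes "simple_graph G" "connected_graph G" "\<rho> \<in> edge_directions G"
    and ex: "\<And>v. \<exists>F\<in>fin_edge_sets G. v \<notin> \<rho> F"
  shows "\<rho> \<in> end_to_direction G ` ends (line_graph G)"
proof -
  obtain F where F: "\<And>n. F n \<in> fin_edge_sets G" "\<And>n. F n \<subseteq> F (Suc n)" "(\<Inter>n. \<rho> (F n)) = {}"
    using direction_nested_components[OF assms] by blast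
  note comp = edge_directionsD(1)[OF assms(3)]
  have "\<rho> (F (Suc n)) \<subseteq> \<rho> (F n)" for n
    using edge_directionsD(3)[OF assms(3)] F by blast
  then have anti: "\<rho> (F n) \<subseteq> \<rho> (F m)" if "m \<le> n" for m n
    using that by (rule lift_Suc_antimono_le)
  obtain r where r: "ray G r" "\<And>n. has_tail_in r (\<rho> (F n))"
    using ray_through_nested_components[OF assms(1) comp[OF F(1)] anti F(3)] by auto
  have "has_tail_in (\<lambda>n. {r n, r (Suc n)}) (Pow (\<rho> E))" if E: "E \<in> fin_edge_sets G" for E
  proof -
    have "finite (\<Union>E)"
      using E simple_graph_edge(2)[OF assms(1)] by (auto simp: fin_edge_sets_def)
    moreover have "\<exists>n. \<rho> (F n) \<inter> W = {}" if "finite W" for W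
      using that
    proof induction
      case (insert x W)
      then obtain n m where "\<rho> (F n) \<inter> W = {}" "x \<notin> \<rho> (F m)" using F(3) by blast
      then have "\<rho> (F (max n m)) \<inter> insert x W = {}"
        using anti[of n "max n m"] anti[of m "max n m"] by auto
      then show ?case ..
    qed simp
    ultimately obtain n where n: "\<rho> (F n) \<inter> \<Union>E = {}" by blast
    obtain x where x: "x \<in> \<rho> (F n)" "x \<in> \<rho> E"
      using edge_directions_meet[OF assms(3) F(1) E] by blast
    have "component_of (del_edges G (F n)) x \<subseteq> \<rho> (F n) \<inter> \<rho> E"
    proof (rule component_of_least)
      fix y z assume y: "y \<in> \<rho> (F n) \<inter> \<rho> E" and yz: "{y, z} \<in> edges (del_edges G (F n))"
      then have "z \<in> \<rho> (F n)" using components_step[OF comp[OF F(1)]] by blast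
      moreover have "{y, z} \<in> edges (del_edges G E)" using y yz n by auto
      ultimately show "z \<in> \<rho> (F n) \<inter> \<rho> E" using components_step[OF comp[OF E]] y by blast
    qed (use x in blast)
    then have "\<rho> (F n) \<subseteq> \<rho> E" using components_eq_component_of[OF comp[OF F(1)] x(1)] by blast
    then have "has_tail_in r (\<rho> E)" using has_tail_in_mono[OF r(2)] by blast
    then show ?thesis unfolding has_tail_in_def by (metis PowI empty_subsetI insert_subset le_SucI)
  qed
  then show ?thesis
    using end_of_line_ray[OF assms(1) ray_edge_ray[OF assms(1) r(1)] assms(3)] by blast
qed

lemma end_to_direction_image:
  assumes "simple_graph G" "connected_graph G"
  shows "end_to_direction G ` ends (line_graph G) = edge_directions G"
proof
  show "edge_directions G \<subseteq> end_to_direction G ` ends (line_graph G)"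
  proof
    fix \<rho> assume \<rho>: "\<rho> \<in> edge_directions G"
    show "\<rho> \<in> end_to_direction G ` ends (line_graph G)"
      using direction_end_at_vertex[OF assms(1) \<rho>] direction_end_of_ray[OF assms \<rho>] by blast
  qed
qed (use end_to_direction_in[OF assms(1)] in blast)

subsection \<open>The cut algebra\<close>

definition edge_boundary :: "'a graph \<Rightarrow> 'a set \<Rightarrow> 'a set set" where
  "edge_boundary G A = {e \<in> edges G. e \<inter> A \<noteq> {} \<and> e \<inter> (verts G - A) \<noteq> {}}"

lemma cut_sets_iff: "A \<in> cut_sets G \<longleftrightarrow> A \<subseteq> verts G \<and> edge_boundary G A \<in> fin_edge_sets G"
  by (auto simp: cut_sets_def edge_boundary_def fin_edge_sets_def)

lemma fin_edge_sets_subset: "F' \<in> fin_edge_sets G \<Longrightarrow> F \<subseteq> F' \<Longrightarrow> F \<in> fin_edge_sets G"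
  unfolding fin_edge_sets_def using finite_subset by fast

lemma edge_boundary_Int: "edge_boundary G (A \<inter> B) \<subseteq> edge_boundary G A \<union> edge_boundary G B"
  by (auto simp: edge_boundary_def)

lemma edge_boundary_compl: "A \<subseteq> verts G \<Longrightarrow> edge_boundary G (verts G - A) = edge_boundary G A"
  by (simp add: edge_boundary_def double_diff conj_commute)

lemma cut_sets_Int: "A \<in> cut_sets G \<Longrightarrow> B \<in> cut_sets G \<Longrightarrow> A \<inter> B \<in> cut_sets G"
  using fin_edge_sets_subset[OF fin_edge_sets_Un edge_boundary_Int]
  by (auto simp: cut_sets_iff)

lemma cut_sets_compl: "A \<in> cut_sets G \<Longrightarrow> verts G - A \<in> cut_sets G"
  by (simp add: cut_sets_iff edge_boundary_compl)

lemma cut_sets_trivial [simp]: "{} \<in> cut_sets G" "verts G \<in> cut_sets G"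
  by (simp_all add: cut_sets_iff edge_boundary_def)

lemma cut_ideal_subset: "A \<in> cut_ideal G \<Longrightarrow> B \<subseteq> A \<Longrightarrow> B \<in> cut_ideal G"
  unfolding cut_ideal_def using finite_subset by fast

lemma cut_ideal_Un: "A \<in> cut_ideal G \<Longrightarrow> B \<in> cut_ideal G \<Longrightarrow> A \<union> B \<in> cut_ideal G"
  by (auto simp: cut_ideal_def)

lemma cut_relI:
  "A \<in> cut_sets G \<Longrightarrow> B \<in> cut_sets G \<Longrightarrow> (A - B) \<union> (B - A) \<subseteq> C \<Longrightarrow> C \<in> cut_ideal G \<Longrightarrow> (A, B) \<in> cut_rel G"
  unfolding cut_rel_def using cut_ideal_subset by blast

lemma cut_relD:
  "(A, B) \<in> cut_rel G \<Longrightarrow> A \<in> cut_sets G \<and> B \<in> cut_sets G \<and> (A - B) \<union> (B - A) \<in> cut_ideal G"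
  by (simp add: cut_rel_def)

lemma equiv_cut_rel: "equiv (cut_sets G) (cut_rel G)"
proof (rule equivI)
  show "cut_rel G \<subseteq> cut_sets G \<times> cut_sets G" by (auto simp: cut_rel_def)
  show "refl_on (cut_sets G) (cut_rel G)" by (auto simp: refl_on_def cut_rel_def cut_ideal_def)
  show "sym (cut_rel G)" by (auto simp: sym_def cut_rel_def Un_commute)
  show "trans (cut_rel G)"
  proof (rule transI)
    fix A B C assume "(A, B) \<in> cut_rel G" "(B, C) \<in> cut_rel G"
    note AB = cut_relD[OF this(1)] and BC = cut_relD[OF this(2)]
    show "(A, C) \<in> cut_rel G"
    proof (rule cut_relI)
      show "(A - C) \<union> (C - A) \<subseteq> ((A - B) \<union> (B - A)) \<union> ((B - C) \<union> (C - B))" by blast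
    qed (use AB BC cut_ideal_Un in blast)+
  qed
qed

abbreviation cut_class :: "'a graph \<Rightarrow> 'a set \<Rightarrow> 'a set set" where
  "cut_class G A \<equiv> cut_rel G `` {A}"

lemma cut_class_eqI: "(A, B) \<in> cut_rel G \<Longrightarrow> cut_class G A = cut_class G B"
  by (rule equiv_class_eq[OF equiv_cut_rel])

lemma cut_class_eq_iff:
  "A \<in> cut_sets G \<Longrightarrow> B \<in> cut_sets G \<Longrightarrow> cut_class G A = cut_class G B \<longleftrightarrow> (A, B) \<in> cut_rel G"
  by (rule eq_equiv_class_iff[OF equiv_cut_rel])

lemma cut_algebra_simps [simp]:
  "ba_carrier (cut_algebra G) = cut_sets G // cut_rel G"
  "ba_zero (cut_algebra G) = cut_class G {}"
  "ba_one (cut_algebra G) = cut_class G (verts G)"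
  by (simp_all add: cut_algebra_def)

lemma cut_class_carrier [simp]: "A \<in> cut_sets G \<Longrightarrow> cut_class G A \<in> cut_sets G // cut_rel G"
  by (rule quotientI)

lemma cut_meet:
  assumes "A \<in> cut_sets G" "B \<in> cut_sets G"
  shows "ba_meet (cut_algebra G) (cut_class G A) (cut_class G B) = cut_class G (A \<inter> B)"
proof -
  have "congruent2 (cut_rel G) (cut_rel G) (\<lambda>A B. cut_class G (A \<inter> B))"
  proof (rule congruent2I')
    fix A A' B B' assume "(A, A') \<in> cut_rel G" "(B, B') \<in> cut_rel G"
    note A = cut_relD[OF this(1)] and B = cut_relD[OF this(2)]
    show "cut_class G (A \<inter> B) = cut_class G (A' \<inter> B')"
    proof (intro cut_class_eqI cut_relI cut_sets_Int)
      show "(A \<inter> B - A' \<inter> B') \<union> (A' \<inter> B' - A \<inter> B) \<subseteq> ((A - A') \<union> (A' - A)) \<union> ((B - B') \<union> (B' - B))" by blast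
    qed (use A B cut_ideal_Un in blast)+
  qed
  from UN_equiv_class2[OF equiv_cut_rel equiv_cut_rel this assms] show ?thesis
    by (simp add: cut_algebra_def)
qed

lemma cut_compl:
  assumes "A \<in> cut_sets G"
  shows "ba_compl (cut_algebra G) (cut_class G A) = cut_class G (verts G - A)"
proof -
  have "congruent (cut_rel G) (\<lambda>A. cut_class G (verts G - A))"
  proof (rule congruentI)
    fix A A' assume "(A, A') \<in> cut_rel G"
    note A = cut_relD[OF this(1)]
    show "cut_class G (verts G - A) = cut_class G (verts G - A')"
    proof (intro cut_class_eqI cut_relI cut_sets_compl)
      show "(verts G - A - (verts G - A')) \<union> (verts G - A' - (verts G - A)) \<subseteq> (A - A') \<union> (A' - A)" by blast
    qed (use A in blast)+
  qed
  from UN_equiv_class[OF equiv_cut_rel this assms] show ?thesis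
    by (simp add: cut_algebra_def)
qed

section \<open>Ultrafilters of the cut algebra as edge-directions\<close>

text \<open>Moves the ultrafilter axioms from the quotient to representing cuts, where meet and
  complement are set operations.\<close>

lemma Ult_cut_algebraD:
  assumes "u \<in> Ult (cut_algebra G)"
  shows "u \<subseteq> cut_sets G // cut_rel G"
    and "cut_class G (verts G) \<in> u" and "cut_class G {} \<notin> u"
    and "A \<in> cut_sets G \<Longrightarrow> B \<in> cut_sets G \<Longrightarrow> cut_class G A \<in> u \<Longrightarrow> cut_class G B \<in> u \<Longrightarrow> cut_class G (A \<inter> B) \<in> u"
    and "A \<in> cut_sets G \<Longrightarrow> B \<in> cut_sets G \<Longrightarrow> cut_class G A \<in> u \<Longrightarrow> A \<subseteq> B \<Longrightarrow> cut_class G B \<in> u"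
    and "A \<in> cut_sets G \<Longrightarrow> cut_class G A \<in> u \<or> cut_class G (verts G - A) \<in> u"
proof -
  have u: "u \<subseteq> cut_sets G // cut_rel G" "cut_class G (verts G) \<in> u" "cut_class G {} \<notin> u"
    "\<And>a b. a \<in> u \<Longrightarrow> b \<in> u \<Longrightarrow> ba_meet (cut_algebra G) a b \<in> u"
    "\<And>a b. a \<in> u \<Longrightarrow> b \<in> cut_sets G // cut_rel G \<Longrightarrow> ba_le (cut_algebra G) a b \<Longrightarrow> b \<in> u"
    "\<And>a. a \<in> cut_sets G // cut_rel G \<Longrightarrow> a \<in> u \<or> ba_compl (cut_algebra G) a \<in> u"
    using assms unfolding Ult_def cut_algebra_simps by blast+
  show "u \<subseteq> cut_sets G // cut_rel G" "cut_class G (verts G) \<in> u" "cut_class G {} \<notin> u" by fact+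
  show "cut_class G (A \<inter> B) \<in> u"
    if "A \<in> cut_sets G" "B \<in> cut_sets G" "cut_class G A \<in> u" "cut_class G B \<in> u"
    using u(4)[OF that(3,4)] cut_meet[OF that(1,2)] by simp
  show "cut_class G B \<in> u" if "A \<in> cut_sets G" "B \<in> cut_sets G" "cut_class G A \<in> u" "A \<subseteq> B"
    using u(5)[OF that(3) cut_class_carrier[OF that(2)]] cut_meet[OF that(1,2)] that(4)
    by (simp add: ba_le_def Int_absorb2)
  show "cut_class G A \<in> u \<or> cut_class G (verts G - A) \<in> u" if "A \<in> cut_sets G"
    using u(6)[OF cut_class_carrier[OF that]] cut_compl[OF that] by simp
qed

lemma component_edge_boundary:
  assumes "simple_graph G" "K \<in> graph_components (del_edges G F)"
  shows "edge_boundary G K \<subseteq> F"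
proof
  fix e assume e: "e \<in> edge_boundary G K"
  then obtain x y where xy: "x \<in> e" "x \<in> K" "y \<in> e" "y \<notin> K" "e \<in> edges G"
    by (auto simp: edge_boundary_def)
  obtain a b where "e = {a, b}" using simple_graph_edgeE[OF assms(1) xy(5)] by metis
  then have "e = {x, y}" using xy(1-4) by auto
  then show "e \<in> F" using components_step[OF assms(2) xy(2), of y] xy by auto
qed

lemma component_in_cut_sets:
  assumes "simple_graph G" "F \<in> fin_edge_sets G" "K \<in> graph_components (del_edges G F)"
  shows "K \<in> cut_sets G"
  using component_edge_boundary[OF assms(1,3)] components_subset_verts[OF simple_del_edges[OF assms(1)] assms(3)]
    fin_edge_sets_subset[OF assms(2)] by (simp add: cut_sets_iff)

text \<open>A walk leaving \<open>A\<close> would use an edge of its boundary, and all of these are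
  deleted; so \<open>A\<close> does not split the component.\<close>

lemma component_subset_cut:
  assumes "simple_graph G" "K \<in> graph_components (del_edges G F)"
    and "A \<subseteq> verts G" "edge_boundary G A \<subseteq> F" "K \<inter> A \<noteq> {}"
  shows "K \<subseteq> A"
proof -
  obtain x where x: "x \<in> K" "x \<in> A" using assms(5) by blast
  have "component_of (del_edges G F) x \<subseteq> A"
  proof (rule component_of_least[OF x(2)], rule ccontr)
    fix y z assume "y \<in> A" "{y, z} \<in> edges (del_edges G F)" "z \<notin> A"
    then show False
      using simple_graphD(2)[OF assms(1), of y z] assms(4) by (auto simp: edge_boundary_def)
  qed
  then show ?thesis using components_eq_component_of[OF assms(2) x(1)] by simp
qed

text \<open>For a finite cut the degree condition is automatic: each edge at a vertex of
  \<open>A\<close> lies inside \<open>A\<close> or in the finite boundary.\<close>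

lemma finite_cut_in_ideal:
  assumes "simple_graph G" "A \<in> cut_sets G" "finite A"
  shows "A \<in> cut_ideal G"
proof -
  have A: "A \<subseteq> verts G" "finite (edge_boundary G A)"
    using assms(2) by (auto simp: cut_sets_iff fin_edge_sets_def)
  have "{e \<in> edges G. v \<in> e} \<subseteq> {e \<in> edges G. e \<subseteq> A} \<union> edge_boundary G A" if "v \<in> A" for v
    using that simple_graph_edge(3)[OF assms(1)] by (auto simp: edge_boundary_def)
  then have "finite {e \<in> edges G. v \<in> e}" if "v \<in> A" for v
    using that A(2) finite_edges_subset[OF assms(1,3)] by (meson finite_UnI finite_subset)
  then show ?thesis using A assms(3) by (auto simp: cut_ideal_def infinite_degree_def)
qed

lemma Ult_infinite:
  assumes "simple_graph G" "u \<in> Ult (cut_algebra G)" "A \<in> cut_sets G" "cut_class G A \<in> u"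
  shows "infinite A"
proof
  assume "finite A"
  then have "(A, {}) \<in> cut_rel G"
    using assms finite_cut_in_ideal by (intro cut_relI[of _ _ _ A]) auto
  then show False using Ult_cut_algebraD(3)[OF assms(2)] assms(4) cut_class_eqI by metis
qed

text \<open>Finitely many components cover the vertices. If none belonged to \<open>u\<close>, the
  intersection of their complements, which is empty, would; and two distinct members of
  \<open>u\<close> would meet in the empty set.\<close>

lemma Ult_component:
  assumes "simple_graph G" "connected_graph G" "u \<in> Ult (cut_algebra G)" "F \<in> fin_edge_sets G"
  shows "\<exists>!K. K \<in> graph_components (del_edges G F) \<and> cut_class G K \<in> u"
proof -
  let ?\<C> = "graph_components (del_edges G F)"
  note U = Ult_cut_algebraD[OF assms(3)]
  note cut = component_in_cut_sets[OF assms(1,4)]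
  have fin: "finite ?\<C>"
    using finite_components_del_edges[OF assms(1,2)] assms(4) by (simp add: fin_edge_sets_def)
  have "\<exists>K\<in>?\<C>. cut_class G K \<in> u"
  proof (rule ccontr)
    assume "\<not> ?thesis"
    then have co: "cut_class G (verts G - K) \<in> u" if "K \<in> ?\<C>" for K using U(6)[OF cut] that by blast
    have "verts G - \<Union>C \<in> cut_sets G \<and> cut_class G (verts G - \<Union>C) \<in> u" if "finite C" "C \<subseteq> ?\<C>" for C
      using that
    proof induction
      case (insert K C)
      have eq: "verts G - \<Union>(insert K C) = (verts G - K) \<inter> (verts G - \<Union>C)" by blast
      show ?case unfolding eq
        using insert co[of K] cut_sets_compl[OF cut, of K] by (intro conjI U(4) cut_sets_Int) auto
    qed (use U(2) in simp)
    from this[OF fin subset_refl] have "cut_class G (verts G - \<Union>?\<C>) \<in> u" by blast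
    moreover have "verts G \<subseteq> \<Union>?\<C>" by (auto simp: graph_components_def intro: component_of_refl)
    ultimately show False using U(3) by (simp add: Diff_eq_empty_iff[THEN iffD2])
  qed
  moreover have "K = K'" if "K \<in> ?\<C>" "K' \<in> ?\<C>" "cut_class G K \<in> u" "cut_class G K' \<in> u" for K K'
  proof -
    have "K \<inter> K' \<noteq> {}" using U(3) U(4)[OF cut[OF that(1)] cut[OF that(2)] that(3,4)] by auto
    then show ?thesis using components_eqI[OF that(1,2)] by blast
  qed
  ultimately show ?thesis by blast
qed

lemma ult_to_direction_component:
  assumes "simple_graph G" "connected_graph G" "u \<in> Ult (cut_algebra G)" "F \<in> fin_edge_sets G"
  shows "ult_to_direction G u F \<in> graph_components (del_edges G F)"
    and "cut_class G (ult_to_direction G u F) \<in> u"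
  using theI'[OF Ult_component[OF assms]] assms(4) by (simp_all add: ult_to_direction_def)

lemma ult_to_direction_eq:
  assumes "F \<in> fin_edge_sets G" "K \<in> graph_components (del_edges G F)"
    and "\<And>K'. K' \<in> graph_components (del_edges G F) \<Longrightarrow> cut_class G K' \<in> u \<longleftrightarrow> K' = K"
  shows "ult_to_direction G u F = K"
proof -
  have "(THE K. K \<in> graph_components (del_edges G F) \<and> cut_class G K \<in> u) = K"
    by (rule the_equality) (use assms in blast)+
  then show ?thesis using assms(1) by (simp add: ult_to_direction_def)
qed

lemma ult_to_direction_in:
  assumes "simple_graph G" "connected_graph G" "u \<in> Ult (cut_algebra G)"
  shows "ult_to_direction G u \<in> edge_directions G"
proof (rule edge_directionsI)
  note U = Ult_cut_algebraD[OF assms(3)]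
  note comp = ult_to_direction_component[OF assms]
  note cut = component_in_cut_sets[OF assms(1) _ comp(1)]
  show "ult_to_direction G u F \<in> graph_components (del_edges G F)" if "F \<in> fin_edge_sets G" for F
    using comp(1)[OF that] .
  show "infinite (ult_to_direction G u F)" if "F \<in> fin_edge_sets G" for F
    using Ult_infinite[OF assms(1,3) cut comp(2)] that by blast
  show "ult_to_direction G u F \<inter> ult_to_direction G u F' \<noteq> {}"
    if F: "F \<in> fin_edge_sets G" "F' \<in> fin_edge_sets G" for F F'
    using U(3) U(4)[OF cut[OF F(1) F(1)] cut[OF F(2) F(2)] comp(2)[OF F(1)] comp(2)[OF F(2)]] by auto
qed (simp add: ult_to_direction_def)

text \<open>The component picked at \<open>F\<close> represents a member of \<open>u\<close>, and it
  lies inside \<open>A\<close> as soon as it meets \<open>A\<close>.\<close>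

lemma Ult_mem_iff:
  assumes "simple_graph G" "connected_graph G" "u \<in> Ult (cut_algebra G)"
    and "A \<in> cut_sets G" "F \<in> fin_edge_sets G" "edge_boundary G A \<subseteq> F"
  shows "cut_class G A \<in> u \<longleftrightarrow> ult_to_direction G u F \<subseteq> A"
proof -
  note U = Ult_cut_algebraD[OF assms(3)]
  note comp = ult_to_direction_component[OF assms(1-3,5)]
  note cut = component_in_cut_sets[OF assms(1,5) comp(1)]
  show ?thesis
  proof
    assume "cut_class G A \<in> u"
    then have "ult_to_direction G u F \<inter> A \<noteq> {}"
      using U(3) U(4)[OF cut assms(4) comp(2)] by auto
    then show "ult_to_direction G u F \<subseteq> A"
      using component_subset_cut[OF assms(1) comp(1) _ assms(6)] assms(4) by (auto simp: cut_sets_iff)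
  qed (use U(5)[OF cut assms(4) comp(2)] in blast)
qed

lemma inj_ult_to_direction:
  assumes "simple_graph G" "connected_graph G"
  shows "inj_on (ult_to_direction G) (Ult (cut_algebra G))"
proof (rule inj_onI)
  have sub: "u \<subseteq> u'" if u: "u \<in> Ult (cut_algebra G)" "u' \<in> Ult (cut_algebra G)"
    and eq: "ult_to_direction G u = ult_to_direction G u'" for u u'
  proof
    fix X assume X: "X \<in> u"
    then have "X \<in> cut_sets G // cut_rel G" using Ult_cut_algebraD(1)[OF u(1)] by blast
    then obtain A where A: "A \<in> cut_sets G" "X = cut_class G A" by (rule quotientE)
    then have "edge_boundary G A \<in> fin_edge_sets G" by (simp add: cut_sets_iff)
    then show "X \<in> u'"
      using Ult_mem_iff[OF assms u(1) A(1) _ subset_refl] Ult_mem_iff[OF assms u(2) A(1) _ subset_refl] X A(2) eq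
      by simp
  qed
  show "u = u'" if "u \<in> Ult (cut_algebra G)" "u' \<in> Ult (cut_algebra G)"
    "ult_to_direction G u = ult_to_direction G u'" for u u'
    using sub[OF that] sub[OF that(2,1) that(3)[symmetric]] by blast
qed

text \<open>The inverse of \<open>ult_to_direction\<close>. The boundary of \<open>A\<close> is the
  least admissible set of deleted edges; by \<open>direction_subset_cut_iff\<close> any larger
  finite set gives the same condition.\<close>

definition direction_ult :: "'a graph \<Rightarrow> ('a set set \<Rightarrow> 'a set) \<Rightarrow> 'a set set set" where
  "direction_ult G \<rho> = {cut_class G A |A. A \<in> cut_sets G \<and> \<rho> (edge_boundary G A) \<subseteq> A}"

lemma direction_subset_cut_iff:
  assumes "simple_graph G" "\<rho> \<in> edge_directions G"
    and "A \<in> cut_sets G" "F \<in> fin_edge_sets G" "edge_boundary G A \<subseteq> F"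
  shows "\<rho> F \<subseteq> A \<longleftrightarrow> \<rho> (edge_boundary G A) \<subseteq> A"
proof -
  have A: "A \<subseteq> verts G" "edge_boundary G A \<in> fin_edge_sets G" using assms(3) by (auto simp: cut_sets_iff)
  note sub = edge_directionsD(3)[OF assms(2) A(2) assms(4,5)]
  have "\<rho> F \<noteq> {}" using edge_directionsD(2)[OF assms(2,4)] by auto
  then have "\<rho> (edge_boundary G A) \<inter> A \<noteq> {}" if "\<rho> F \<subseteq> A" using that sub by blast
  then show ?thesis
    using component_subset_cut[OF assms(1) edge_directionsD(1)[OF assms(2) A(2)] A(1) subset_refl] sub by blast
qed

text \<open>Membership is witnessed by some representative \<open>B\<close> of the class, not by
  \<open>A\<close>. As \<open>B - A\<close> is finite, an infinite component inside \<open>B\<close>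
  must meet \<open>A\<close>, and then the component at \<open>F\<close> lies in
  \<open>A\<close>.\<close>

lemma direction_ult_mem_iff:
  assumes "simple_graph G" "\<rho> \<in> edge_directions G"
    and "A \<in> cut_sets G" "F \<in> fin_edge_sets G" "edge_boundary G A \<subseteq> F"
  shows "cut_class G A \<in> direction_ult G \<rho> \<longleftrightarrow> \<rho> F \<subseteq> A"
proof
  assume "cut_class G A \<in> direction_ult G \<rho>"
  then obtain B where B: "B \<in> cut_sets G" "\<rho> (edge_boundary G B) \<subseteq> B" "(A, B) \<in> cut_rel G"
    using cut_class_eq_iff[OF assms(3)] by (auto simp: direction_ult_def)
  have bB: "edge_boundary G B \<in> fin_edge_sets G" using B(1) by (simp add: cut_sets_iff)
  define F' where "F' = F \<union> edge_boundary G B"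
  have F': "F' \<in> fin_edge_sets G" using fin_edge_sets_Un[OF assms(4) bB] by (simp add: F'_def)
  have "\<rho> F' \<subseteq> B"
    using direction_subset_cut_iff[OF assms(1,2) B(1) F'] B(2) by (simp add: F'_def)
  moreover have "finite (B - A)" using cut_relD[OF B(3)] by (auto simp: cut_ideal_def)
  ultimately have "\<rho> F' \<inter> A \<noteq> {}"
    using edge_directionsD(2)[OF assms(2) F'] finite_subset[of "\<rho> F'" "B - A"] by blast
  then have "\<rho> F \<inter> A \<noteq> {}"
    using edge_directionsD(3)[OF assms(2,4) F'] by (auto simp: F'_def)
  then show "\<rho> F \<subseteq> A"
    using component_subset_cut[OF assms(1) edge_directionsD(1)[OF assms(2,4)] _ assms(5)] assms(3)
    by (auto simp: cut_sets_iff)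
qed (use direction_subset_cut_iff[OF assms] assms(3) in \<open>auto simp: direction_ult_def\<close>)

lemma direction_ult_in:
  assumes "simple_graph G" "\<rho> \<in> edge_directions G"
  shows "direction_ult G \<rho> \<in> Ult (cut_algebra G)"
proof -
  let ?u = "direction_ult G \<rho>"
  note mem = direction_ult_mem_iff[OF assms]
  have fin: "edge_boundary G A \<in> fin_edge_sets G" if "A \<in> cut_sets G" for A using that by (simp add: cut_sets_iff)
  have sub: "?u \<subseteq> cut_sets G // cut_rel G"
    by (auto simp: direction_ult_def intro: quotientI)
  have ne: "\<rho> F \<noteq> {}" if "F \<in> fin_edge_sets G" for F using edge_directionsD(2)[OF assms(2) that] by auto
  have one: "cut_class G (verts G) \<in> ?u"
    using mem[OF cut_sets_trivial(2) fin[OF cut_sets_trivial(2)] subset_refl]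
      components_subset_verts[OF simple_del_edges[OF assms(1)] edge_directionsD(1)[OF assms(2) fin[OF cut_sets_trivial(2)]]]
    by simp
  have zero: "cut_class G {} \<notin> ?u"
    using mem[OF cut_sets_trivial(1) fin[OF cut_sets_trivial(1)] subset_refl] ne[OF fin[OF cut_sets_trivial(1)]] by simp
  \<comment> \<open>Both boundaries are deleted at once, so that the three memberships concern one
    and the same component.\<close>
  have common: "(cut_class G A \<in> ?u \<longleftrightarrow> \<rho> (edge_boundary G A \<union> edge_boundary G B) \<subseteq> A)"
    "(cut_class G B \<in> ?u \<longleftrightarrow> \<rho> (edge_boundary G A \<union> edge_boundary G B) \<subseteq> B)"
    "(cut_class G (A \<inter> B) \<in> ?u \<longleftrightarrow> \<rho> (edge_boundary G A \<union> edge_boundary G B) \<subseteq> A \<inter> B)"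
    if "A \<in> cut_sets G" "B \<in> cut_sets G" for A B
    using mem[OF that(1) fin_edge_sets_Un[OF fin fin], OF that] mem[OF that(2) fin_edge_sets_Un[OF fin fin], OF that]
      mem[OF cut_sets_Int fin_edge_sets_Un[OF fin fin] edge_boundary_Int, OF that that] by simp_all
  have meet: "ba_meet (cut_algebra G) X Y \<in> ?u" if XY: "X \<in> ?u" "Y \<in> ?u" for X Y
  proof -
    obtain A B where "A \<in> cut_sets G" "B \<in> cut_sets G" "X = cut_class G A" "Y = cut_class G B"
      using XY unfolding direction_ult_def by blast
    then show ?thesis using common[of A B] cut_meet[of A G B] XY by simp
  qed
  have up: "Y \<in> ?u" if XY: "X \<in> ?u" "Y \<in> cut_sets G // cut_rel G" "ba_le (cut_algebra G) X Y" for X Y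
  proof -
    obtain A where A: "A \<in> cut_sets G" "X = cut_class G A" using XY(1) unfolding direction_ult_def by blast
    obtain B where B: "B \<in> cut_sets G" "Y = cut_class G B" using XY(2) by (rule quotientE)
    show ?thesis using common[OF A(1) B(1)] cut_meet[OF A(1) B(1)] XY A B by (simp add: ba_le_def)
  qed
  have compl: "X \<in> ?u \<or> ba_compl (cut_algebra G) X \<in> ?u" if X: "X \<in> cut_sets G // cut_rel G" for X
  proof -
    obtain A where A: "A \<in> cut_sets G" "X = cut_class G A" using X by (rule quotientE)
    have AV: "A \<subseteq> verts G" using A(1) by (simp add: cut_sets_iff)
    let ?K = "\<rho> (edge_boundary G A)"
    have K: "?K \<in> graph_components (del_edges G (edge_boundary G A))"
      using edge_directionsD(1)[OF assms(2) fin[OF A(1)]] .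
    \<comment> \<open>The ultrafilter dichotomy: \<open>A\<close> does not split the component at
      its boundary, and the complement of \<open>A\<close> has the same boundary.\<close>
    have "?K \<subseteq> A \<or> ?K \<subseteq> verts G - A"
      using component_subset_cut[OF assms(1) K AV subset_refl]
        components_subset_verts[OF simple_del_edges[OF assms(1)] K] by auto
    then show ?thesis
      using mem[OF A(1) fin[OF A(1)] subset_refl]
        mem[OF cut_sets_compl[OF A(1)] fin[OF A(1)]] edge_boundary_compl[OF AV] cut_compl[OF A(1)] A(2)
      by simp
  qed
  show ?thesis
    unfolding Ult_def cut_algebra_simps using sub one zero meet up compl by blast
qed

lemma ult_to_direction_direction_ult:
  assumes "simple_graph G" "connected_graph G" "\<rho> \<in> edge_directions G"
  shows "ult_to_direction G (direction_ult G \<rho>) = \<rho>"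
proof (rule extensionalityI[OF _ edge_directionsD(4)[OF assms(3)]])
  fix F assume F: "F \<in> fin_edge_sets G"
  note K = edge_directionsD(1)[OF assms(3) F]
  note U = direction_ult_in[OF assms(1,3)]
  have "cut_class G (\<rho> F) \<in> direction_ult G \<rho>"
    using direction_ult_mem_iff[OF assms(1,3) component_in_cut_sets[OF assms(1) F K] F
      component_edge_boundary[OF assms(1) K]] by simp
  then show "ult_to_direction G (direction_ult G \<rho>) F = \<rho> F"
    using Ult_component[OF assms(1,2) U F] K by (intro ult_to_direction_eq[OF F]) blast+
qed (simp add: ult_to_direction_def)

lemma ult_to_direction_image:
  assumes "simple_graph G" "connected_graph G"
  shows "ult_to_direction G ` Ult (cut_algebra G) = edge_directions G"
proof
  show "edge_directions G \<subseteq> ult_to_direction G ` Ult (cut_algebra G)"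
    using ult_to_direction_direction_ult[OF assms] direction_ult_in[OF assms(1)] by (metis image_eqI subsetI)
qed (use ult_to_direction_in[OF assms] in blast)

subsection \<open>The canonical homeomorphisms\<close>

text \<open>Openness of the images of generators is continuity of the inverse, and continuity may be
  tested on generators.\<close>

lemma homeomorphic_map_generated_by:
  assumes "inj_on f (\<Union>S)" "f ` \<Union>S = \<Union>T"
    and "\<And>U. U \<in> T \<Longrightarrow> openin (topology_generated_by S) (f -` U \<inter> \<Union>S)"
    and "\<And>U. U \<in> S \<Longrightarrow> openin (topology_generated_by T) (f ` U)"
  shows "homeomorphic_map (topology_generated_by S) (topology_generated_by T) f"
proof -
  let ?g = "inv_into (\<Union>S) f"
  have cont: "continuous_map (topology_generated_by S) (topology_generated_by T) f"
    using assms(2,3) by (intro continuous_on_generated_topo) auto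
  have "?g -` U \<inter> \<Union>T = f ` U" if "U \<in> S" for U
  proof -
    have "U \<subseteq> \<Union>S" using that by blast
    show ?thesis
    proof (intro equalityI subsetI)
      fix y assume y: "y \<in> ?g -` U \<inter> \<Union>T"
      then have "f (?g y) = y" unfolding assms(2)[symmetric] by (simp add: f_inv_into_f)
      then show "y \<in> f ` U" using y by (metis IntD1 imageI vimageD)
    next
      fix y assume "y \<in> f ` U"
      then obtain x where x: "x \<in> U" "y = f x" by blast
      then have "x \<in> \<Union>S" using \<open>U \<subseteq> \<Union>S\<close> by blast
      then show "y \<in> ?g -` U \<inter> \<Union>T"
        using x assms(1) unfolding assms(2)[symmetric] by (simp add: inv_into_f_f del: Union_iff)
    qed
  qed
  then have "openin (topology_generated_by T) (?g -` U \<inter> topspace (topology_generated_by T))" if "U \<in> S" for U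
    using that assms(4) by (simp del: Union_iff)
  moreover have "?g ` topspace (topology_generated_by T) \<subseteq> \<Union>S"
    unfolding topology_generated_by_topspace assms(2)[symmetric] by (meson image_subsetI inv_into_into)
  ultimately have "continuous_map (topology_generated_by T) (topology_generated_by S) ?g"
    by (intro continuous_on_generated_topo)
  with cont have "homeomorphic_maps (topology_generated_by S) (topology_generated_by T) f ?g"
    using assms(1,2) by (auto simp: homeomorphic_maps_def inv_into_f_f f_inv_into_f)
  then show ?thesis by (rule homeomorphic_maps_imp_map)
qed

definition direction_basis :: "'a graph \<Rightarrow> ('a set set \<Rightarrow> 'a set) set set" where
  "direction_basis G = {{\<rho>' \<in> edge_directions G. \<rho>' F = \<rho> F} |F \<rho>. F \<in> fin_edge_sets G \<and> \<rho> \<in> edge_directions G}"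

lemma Union_direction_basis: "\<Union>(direction_basis G) = edge_directions G"
proof
  show "edge_directions G \<subseteq> \<Union>(direction_basis G)"
  proof
    fix \<rho> assume \<rho>: "\<rho> \<in> edge_directions G"
    then have "{\<rho>' \<in> edge_directions G. \<rho>' {} = \<rho> {}} \<in> direction_basis G"
      unfolding direction_basis_def using fin_edge_sets_empty[of G] by blast
    then show "\<rho> \<in> \<Union>(direction_basis G)" by (rule UnionI) (use \<rho> in simp)
  qed
qed (auto simp: direction_basis_def)

lemma edge_direction_topology_eq: "edge_direction_topology G = topology_generated_by (direction_basis G)"
  by (simp add: edge_direction_topology_def direction_basis_def)

lemma homeomorphic_map_ult_to_direction:
  assumes "simple_graph G" "connected_graph G"
  shows "homeomorphic_map (ult_topology (cut_algebra G)) (edge_direction_topology G) (ult_to_direction G)"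
proof -
  let ?U = "Ult (cut_algebra G)"
  define S where "S = {{u \<in> ?U. b \<in> u} |b. b \<in> cut_sets G // cut_rel G}"
  have US: "\<Union>S = ?U"
  proof
    have "{u \<in> ?U. cut_class G (verts G) \<in> u} \<in> S"
      unfolding S_def using cut_class_carrier[OF cut_sets_trivial(2)] by blast
    moreover have "?U \<subseteq> {u \<in> ?U. cut_class G (verts G) \<in> u}"
      using Ult_cut_algebraD(2) by blast
    ultimately show "?U \<subseteq> \<Union>S" by (meson Union_upper subset_trans)
  qed (auto simp: S_def)
  have "homeomorphic_map (topology_generated_by S) (topology_generated_by (direction_basis G)) (ult_to_direction G)"
  proof (rule homeomorphic_map_generated_by, unfold US Union_direction_basis)
    fix V assume "V \<in> direction_basis G"
    then obtain F \<rho> where F: "F \<in> fin_edge_sets G" and \<rho>: "\<rho> \<in> edge_directions G"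
      and V: "V = {\<rho>' \<in> edge_directions G. \<rho>' F = \<rho> F}" by (auto simp: direction_basis_def)
    note K = edge_directionsD(1)[OF \<rho> F]
    have "ult_to_direction G u F = \<rho> F \<longleftrightarrow> cut_class G (\<rho> F) \<in> u" if "u \<in> ?U" for u
      using Ult_component[OF assms that F] ult_to_direction_component[OF assms that F] K by metis
    then have "ult_to_direction G -` V \<inter> ?U = {u \<in> ?U. cut_class G (\<rho> F) \<in> u}"
      using ult_to_direction_in[OF assms] V by auto
    also have "\<dots> \<in> S"
      using component_in_cut_sets[OF assms(1) F K] by (auto simp: S_def intro: quotientI)
    finally show "openin (topology_generated_by S) (ult_to_direction G -` V \<inter> ?U)"
      by (rule topology_generated_by_Basis)
  next
    fix V assume "V \<in> S"
    then obtain b where b: "b \<in> cut_sets G // cut_rel G" "V = {u \<in> ?U. b \<in> u}" by (auto simp: S_def)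
    then obtain A where A: "A \<in> cut_sets G" "b = cut_class G A" by (auto elim: quotientE)
    have F: "edge_boundary G A \<in> fin_edge_sets G" using A(1) by (simp add: cut_sets_iff)
    have V: "V = {u \<in> ?U. ult_to_direction G u (edge_boundary G A) \<subseteq> A}"
      using Ult_mem_iff[OF assms _ A(1) F subset_refl] b(2) A(2) by blast
    have "ult_to_direction G ` V = {\<rho> \<in> edge_directions G. \<rho> (edge_boundary G A) \<subseteq> A}"
      unfolding V ult_to_direction_image[OF assms, symmetric] by blast
    \<comment> \<open>Several components may lie inside \<open>A\<close>, so the image is a union of
      basic sets, one for each possible value at the boundary.\<close>
    also have "\<dots> = \<Union>{{\<rho>' \<in> edge_directions G. \<rho>' (edge_boundary G A) = \<rho> (edge_boundary G A)} |\<rho>.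
        \<rho> \<in> edge_directions G \<and> \<rho> (edge_boundary G A) \<subseteq> A}" by auto
    finally have eq: "ult_to_direction G ` V = \<dots>" .
    show "openin (topology_generated_by (direction_basis G)) (ult_to_direction G ` V)"
      unfolding eq
    proof (rule openin_Union, rule topology_generated_by_Basis)
      fix W assume "W \<in> {{\<rho>' \<in> edge_directions G. \<rho>' (edge_boundary G A) = \<rho> (edge_boundary G A)} |\<rho>.
        \<rho> \<in> edge_directions G \<and> \<rho> (edge_boundary G A) \<subseteq> A}"
      then show "W \<in> direction_basis G" unfolding direction_basis_def using F by blast
    qed
  qed (simp_all add: inj_ult_to_direction ult_to_direction_image assms)
  then show ?thesis by (simp add: ult_topology_def S_def edge_direction_topology_eq)
qed

lemma homeomorphic_map_end_to_direction:
  assumes "simple_graph G" "connected_graph G"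
  shows "homeomorphic_map (end_topology (line_graph G)) (edge_direction_topology G) (end_to_direction G)"
proof -
  let ?E = "ends (line_graph G)"
  let ?B = "\<lambda>F \<epsilon>. {\<eta> \<in> ?E. end_component (line_graph G) F \<eta> = end_component (line_graph G) F \<epsilon>}"
  define S where "S = {?B F \<epsilon> |F \<epsilon>. finite F \<and> F \<subseteq> verts (line_graph G) \<and> \<epsilon> \<in> ?E}"
  have basis: "S = {?B F \<epsilon> |F \<epsilon>. F \<in> fin_edge_sets G \<and> \<epsilon> \<in> ?E}"
    unfolding S_def fin_edge_sets_def by simp
  have US: "\<Union>S = ?E"
  proof
    show "?E \<subseteq> \<Union>S"
    proof
      fix \<epsilon> assume \<epsilon>: "\<epsilon> \<in> ?E"
      then have "?B {} \<epsilon> \<in> S" unfolding basis using fin_edge_sets_empty[of G] by blast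
      then show "\<epsilon> \<in> \<Union>S" by (rule UnionI) (use \<epsilon> in simp)
    qed
  qed (auto simp: basis)
  \<comment> \<open>The direction depends on the end only through \<open>end_component\<close>, and
    conversely its value determines \<open>end_component\<close> as the edge set of that
    component.\<close>
  have eq: "end_component (line_graph G) F \<eta> = end_component (line_graph G) F \<epsilon> \<longleftrightarrow>
      end_to_direction G \<eta> F = end_to_direction G \<epsilon> F"
    if "\<eta> \<in> ?E" "\<epsilon> \<in> ?E" "F \<in> fin_edge_sets G" for \<eta> \<epsilon> F
    using end_component_line_graph[OF assms(1) that(1,3)] end_component_line_graph[OF assms(1) that(2,3)] that(3)
    by (auto simp: end_to_direction_def edges_within_def)
  have image: "end_to_direction G ` ?B F \<epsilon> = {\<rho>' \<in> edge_directions G. \<rho>' F = end_to_direction G \<epsilon> F}"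
    and preimage: "end_to_direction G -` {\<rho>' \<in> edge_directions G. \<rho>' F = end_to_direction G \<epsilon> F} \<inter> ?E = ?B F \<epsilon>"
    if "\<epsilon> \<in> ?E" "F \<in> fin_edge_sets G" for \<epsilon> F
    unfolding end_to_direction_image[OF assms, symmetric] using eq that by auto
  have "homeomorphic_map (topology_generated_by S) (topology_generated_by (direction_basis G)) (end_to_direction G)"
  proof (rule homeomorphic_map_generated_by, unfold US Union_direction_basis)
    fix V assume "V \<in> direction_basis G"
    then obtain F \<epsilon> where F: "F \<in> fin_edge_sets G" "\<epsilon> \<in> ?E"
      "V = {\<rho>' \<in> edge_directions G. \<rho>' F = end_to_direction G \<epsilon> F}"
      unfolding direction_basis_def end_to_direction_image[OF assms, symmetric] by auto
    then have "end_to_direction G -` V \<inter> ?E \<in> S" using preimage unfolding basis by blast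
    then show "openin (topology_generated_by S) (end_to_direction G -` V \<inter> ?E)"
      by (rule topology_generated_by_Basis)
  next
    fix V assume "V \<in> S"
    then obtain F \<epsilon> where F: "F \<in> fin_edge_sets G" "\<epsilon> \<in> ?E" "V = ?B F \<epsilon>" unfolding basis by blast
    then have "end_to_direction G ` V \<in> direction_basis G"
      using image[OF F(2,1)] end_to_direction_in[OF assms(1) F(2)] F(1) unfolding direction_basis_def
      by (intro CollectI exI[of _ F] exI[of _ "end_to_direction G \<epsilon>"]) simp
    then show "openin (topology_generated_by (direction_basis G)) (end_to_direction G ` V)"
      by (rule topology_generated_by_Basis)
  qed (simp_all add: inj_end_to_direction end_to_direction_image assms)
  then show ?thesis by (simp add: end_topology_def S_def edge_direction_topology_eq)
qed

lemma canonical_identificationsI: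
  "simple_graph G \<Longrightarrow> connected_graph G \<Longrightarrow> canonical_identifications G"
  by (simp add: canonical_identifications_def homeomorphic_map_ult_to_direction homeomorphic_map_end_to_direction)

subsection \<open>Strongly line-proper morphisms\<close>

lemma vertex_direction_in:
  assumes "simple_graph G" "infinite_degree G v"
  shows "vertex_direction G v \<in> edge_directions G"
proof (rule edge_directionsI)
  have v: "v \<in> verts G" "infinite {e \<in> edges G. v \<in> e}"
    using assms(2) by (auto simp: infinite_degree_def)
  show "infinite (vertex_direction G v F)" if F: "F \<in> fin_edge_sets G" for F
  proof
    assume "finite (vertex_direction G v F)"
    then have K: "finite (component_of (del_edges G F) v)" (is "finite ?K")
      using F by (simp add: vertex_direction_def)
    \<comment> \<open>A surviving edge at \<open>v\<close> has both ends in the component. A finite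
      component contains finitely many edges, which would make the degree of \<open>v\<close>
      finite.\<close>
    have "{e \<in> edges G. v \<in> e} \<subseteq> F \<union> {e \<in> edges G. e \<subseteq> ?K}"
    proof clarify
      fix e x assume e: "e \<in> edges G" "v \<in> e" "e \<notin> F" "x \<in> e"
      obtain a b where "e = {a, b}" using simple_graph_edgeE[OF assms(1) e(1)] by metis
      then have "x = v \<or> e = {v, x}" using e by auto
      then show "x \<in> ?K" using component_of_step[OF component_of_refl, of v x "del_edges G F"] e by auto
    qed
    moreover have "finite F" using F by (simp add: fin_edge_sets_def)
    ultimately show False
      using v(2) finite_edges_subset[OF assms(1) K] by (meson finite_UnI finite_subset)
  qed
  show "vertex_direction G v F \<inter> vertex_direction G v F' \<noteq> {}"
    if F: "F \<in> fin_edge_sets G" "F' \<in> fin_edge_sets G" for F F'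
  proof -
    have "v \<in> vertex_direction G v F \<inter> vertex_direction G v F'" using F by (simp add: vertex_direction_def)
    then show ?thesis by blast
  qed
qed (use assms in \<open>simp_all add: vertex_direction_def infinite_degree_def\<close>)

lemma ray_direction_component:
  assumes "simple_graph G" "ray G r" "F \<in> fin_edge_sets G"
  shows "ray_direction G r F \<in> graph_components (del_edges G F)"
    and "has_tail_in r (ray_direction G r F)"
proof -
  obtain K where K: "K \<in> graph_components (del_edges G F)" "has_tail_in r K"
    using ray_tail_in_del_edges_component[OF assms(2) _ _ assms(1), of F] assms(3)
    by (auto simp: fin_edge_sets_def)
  then have "(THE K. K \<in> graph_components (del_edges G F) \<and> has_tail_in r K) = K"
    using tail_component_unique by (intro the_equality) blast+
  then show "ray_direction G r F \<in> graph_components (del_edges G F)"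
    and "has_tail_in r (ray_direction G r F)"
    using K assms(3) by (simp_all add: ray_direction_def)
qed

lemma ray_direction_in:
  assumes "simple_graph G" "ray G r"
  shows "ray_direction G r \<in> edge_directions G"
proof (rule edge_directionsI)
  note rd = ray_direction_component[OF assms]
  show "infinite (ray_direction G r F)" if "F \<in> fin_edge_sets G" for F
    using inj_tail_infinite[OF _ rd(2)[OF that]] assms(2) by (simp add: ray_def)
  show "ray_direction G r F \<inter> ray_direction G r F' \<noteq> {}"
    if "F \<in> fin_edge_sets G" "F' \<in> fin_edge_sets G" for F F'
    using has_tail_in_both[OF rd(2)[OF that(1)] rd(2)[OF that(2)]] by blast
qed (use ray_direction_component[OF assms] in \<open>auto simp: ray_direction_def\<close>)

text \<open>The contrapositive of \<open>direction_avoids_finite\<close> gives a vertex of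
  \<open>W\<close> in all values, and this common vertex identifies the direction. It leaves
  infinite degree vertices as the only exceptions to uniqueness for images of rays.\<close>

lemma always_meets_eq_vertex_direction:
  assumes "simple_graph G" "\<rho> \<in> edge_directions G" "finite W" "always_meets G \<rho> W"
  shows "\<exists>v\<in>W. infinite_degree G v \<and> \<rho> = vertex_direction G v"
proof -
  have "\<exists>v\<in>W. \<forall>F\<in>fin_edge_sets G. v \<in> \<rho> F"
    using direction_avoids_finite[OF assms(2,3)] assms(4) unfolding always_meets_def by meson
  then obtain v where v: "v \<in> W" "\<And>F. F \<in> fin_edge_sets G \<Longrightarrow> v \<in> \<rho> F" by blast
  have deg: "infinite_degree G v"
    using always_in_direction_infinite_degree[OF assms(1,2) v(2)] .
  have "\<rho> = vertex_direction G v"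
  proof (rule edge_directions_eqI[OF assms(2) vertex_direction_in[OF assms(1) deg]], intro exI conjI)
    show "v \<in> vertex_direction G v F" if "F \<in> fin_edge_sets G" for F
      using that by (simp add: vertex_direction_def)
  qed (rule v(2))
  then show ?thesis using v deg by blast
qed

section \<open>Images of components, line graph rays and ends\<close>

locale line_proper_morphism =
  fixes G1 :: "'a graph" and G2 :: "'b graph" and \<phi> :: "'a \<Rightarrow> 'b"
  assumes simple1: "simple_graph G1" and simple2: "simple_graph G2"
    and conn1: "connected_graph G1" and conn2: "connected_graph G2"
    and proper: "strongly_line_proper G1 G2 \<phi>"
begin

definition pull :: "'b set set \<Rightarrow> 'a set set" where
  "pull F = {e \<in> edges G1. line_map \<phi> e \<in> F}"

lemma hom_verts: "v \<in> verts G1 \<Longrightarrow> \<phi> v \<in> verts G2"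
  using proper by (auto simp: strongly_line_proper_def graph_hom_def)

lemma hom_edge: "{u, v} \<in> edges G1 \<Longrightarrow> {\<phi> u, \<phi> v} \<in> edges G2"
  using proper by (auto simp: strongly_line_proper_def graph_hom_def)

lemma line_map_edge: "e \<in> edges G1 \<Longrightarrow> line_map \<phi> e \<in> edges G2"
proof -
  assume e: "e \<in> edges G1"
  obtain x y where "e = {x, y}" using simple_graph_edgeE[OF simple1 e] by metis
  then show "line_map \<phi> e \<in> edges G2" using hom_edge[of x y] e by (simp add: line_map_def)
qed

lemma finite_fibre: "e \<in> edges G2 \<Longrightarrow> finite {e' \<in> edges G1. line_map \<phi> e' = e}"
  using proper by (auto simp: strongly_line_proper_def)

lemma finite_pull: "finite F \<Longrightarrow> F \<subseteq> edges G2 \<Longrightarrow> finite (pull F)"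
proof -
  assume "finite F" "F \<subseteq> edges G2"
  then have "finite (\<Union>e\<in>F. {e' \<in> edges G1. line_map \<phi> e' = e})" using finite_fibre by blast
  then show "finite (pull F)" by (rule rev_finite_subset) (auto simp: pull_def)
qed

lemma pull_fin: "F \<in> fin_edge_sets G2 \<Longrightarrow> pull F \<in> fin_edge_sets G1"
  using finite_pull by (auto simp: fin_edge_sets_def pull_def)

text \<open>All edges at \<open>v\<close> lie over edges at \<open>\<phi> v\<close>, finitely many
  over each; finite degree of \<open>\<phi> v\<close> would pass to \<open>v\<close>.\<close>

lemma image_infinite_degree:
  assumes "infinite_degree G1 v"
  shows "infinite_degree G2 (\<phi> v)"
proof -
  have v: "v \<in> verts G1" "infinite {e \<in> edges G1. v \<in> e}"
    using assms by (auto simp: infinite_degree_def)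
  have "{e \<in> edges G1. v \<in> e} \<subseteq> pull {e \<in> edges G2. \<phi> v \<in> e}"
    using line_map_edge by (auto simp: pull_def) (simp add: line_map_def)
  then have "infinite {e \<in> edges G2. \<phi> v \<in> e}"
    using v(2) finite_pull[of "{e \<in> edges G2. \<phi> v \<in> e}"] finite_subset by auto
  then show ?thesis using hom_verts[OF v(1)] by (simp add: infinite_degree_def)
qed

text \<open>An edge outside \<open>pull F\<close> goes to an edge outside \<open>F\<close>, so walks
  avoiding \<open>pull F\<close> have images avoiding \<open>F\<close>.\<close>

lemma component_image:
  assumes "K \<in> graph_components (del_edges G1 (pull F))"
  shows "\<exists>L\<in>graph_components (del_edges G2 F). \<phi> ` K \<subseteq> L"
proof -
  obtain v where v: "v \<in> verts G1" "K = component_of (del_edges G1 (pull F)) v"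
    using assms by (auto simp: graph_components_def)
  let ?L = "component_of (del_edges G2 F) (\<phi> v)"
  have "K \<subseteq> {x. \<phi> x \<in> ?L}"
    unfolding v(2)
  proof (rule component_of_least)
    fix x y assume x: "x \<in> {x. \<phi> x \<in> ?L}" and xy: "{x, y} \<in> edges (del_edges G1 (pull F))"
    then have "{\<phi> x, \<phi> y} \<in> edges (del_edges G2 F)"
      using hom_edge[of x y] by (auto simp: pull_def line_map_def)
    then show "y \<in> {x. \<phi> x \<in> ?L}" using x component_of_step by fast
  qed simp
  then show ?thesis using hom_verts[OF v(1)] by (intro bexI[of _ ?L]) auto
qed

definition push :: "('a set set \<Rightarrow> 'a set) \<Rightarrow> 'b set set \<Rightarrow> 'b set" where
  "push \<rho> F = (THE L. L \<in> graph_components (del_edges G2 F) \<and> \<phi> ` \<rho> (pull F) \<subseteq> L)"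

lemma push_unique:
  assumes "\<rho> \<in> edge_directions G1" "F \<in> fin_edge_sets G2"
  shows "\<exists>!L. L \<in> graph_components (del_edges G2 F) \<and> \<phi> ` \<rho> (pull F) \<subseteq> L"
proof -
  note K = edge_directionsD(1)[OF assms(1) pull_fin[OF assms(2)]]
  obtain x where "x \<in> \<rho> (pull F)" using components_nonempty[OF K] by blast
  then show ?thesis using component_image[OF K] components_eqI[of _ "del_edges G2 F" _ "\<phi> x"] by blast
qed

lemma push_component:
  assumes "\<rho> \<in> edge_directions G1" "F \<in> fin_edge_sets G2"
  shows "push \<rho> F \<in> graph_components (del_edges G2 F)" "\<phi> ` \<rho> (pull F) \<subseteq> push \<rho> F"
  using theI'[OF push_unique[OF assms]] unfolding push_def by blast+

lemma image_tail:
  assumes "\<rho> \<in> edge_directions G1" "F \<in> fin_edge_sets G2" "has_tail_in r (Pow (\<rho> (pull F)))"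
  shows "has_tail_in (\<lambda>n. line_map \<phi> (r n)) (Pow (push \<rho> F))"
  using push_component(2)[OF assms(1,2)] assms(3) unfolding has_tail_in_def line_map_def by fast

text \<open>Properness acts on rays here: \<open>r\<close> is injective and only finitely many edges
  lie over a given one. The image may pause, because two edges at a common vertex can have the same
  image.\<close>

lemma image_sequence:
  assumes "ray (line_graph G1) r"
  shows "finite {i. line_map \<phi> (r i) = x}" "line_map \<phi> (r i) \<in> edges G2"
    and "line_map \<phi> (r (Suc i)) = line_map \<phi> (r i) \<or>
      {line_map \<phi> (r i), line_map \<phi> (r (Suc i))} \<in> edges (line_graph G2)"
proof -
  have r: "r i \<in> edges G1" for i using ray_nth[OF assms] by simp
  then show im: "line_map \<phi> (r i) \<in> edges G2" for i by (rule line_map_edge)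
  \<comment> \<open>\<open>x\<close> is arbitrary; the intersection with \<open>edges G2\<close>
    makes \<open>finite_pull\<close> applicable even if \<open>x\<close> is not an edge.\<close>
  have "finite (pull ({x} \<inter> edges G2))" by (rule finite_pull) auto
  moreover have "{i. line_map \<phi> (r i) = x} = r -` pull ({x} \<inter> edges G2)"
    using r im by (auto simp: pull_def)
  ultimately show "finite {i. line_map \<phi> (r i) = x}"
    using finite_vimageI[of _ r] assms by (simp add: ray_def)
  have "r i \<inter> r (Suc i) \<noteq> {}" using assms by (simp add: ray_def edges_line_graph_iff)
  then have "line_map \<phi> (r i) \<inter> line_map \<phi> (r (Suc i)) \<noteq> {}" by (auto simp: line_map_def)
  then show "line_map \<phi> (r (Suc i)) = line_map \<phi> (r i) \<or>
      {line_map \<phi> (r i), line_map \<phi> (r (Suc i))} \<in> edges (line_graph G2)"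
    using im by (auto simp: edges_line_graph_iff)
qed

text \<open>Every vertex of \<open>s\<close> is the image of some \<open>r j\<close>, but nothing
  controls the order of the indices \<open>j\<close>. Since \<open>s\<close> is injective, it
  eventually avoids the finitely many images with \<open>j < N\<close>; one later edge then decides
  the component.\<close>

lemma ray_in_image_tail:
  assumes "\<rho> \<in> edge_directions G1" "F \<in> fin_edge_sets G2" "has_tail_in r (Pow (\<rho> (pull F)))"
    and "ray (line_graph G1) r" "ray_in_image (line_graph G2) (line_map \<phi>) r s"
  shows "has_tail_in s (Pow (push \<rho> F))"
proof -
  have s: "ray (line_graph G2) s" "\<And>i. \<exists>j. s i = line_map \<phi> (r j)"
    using assms(5) unfolding ray_in_image_def by (blast, metis doubleton_eq_iff)
  obtain N where N: "\<And>j. j \<ge> N \<Longrightarrow> line_map \<phi> (r j) \<subseteq> push \<rho> F"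
    using image_tail[OF assms(1-3)] unfolding has_tail_in_def by auto
  have "finite F" using assms(2) by (simp add: fin_edge_sets_def)
  from line_ray_tail[OF simple2 s(1) this]
  obtain K where K: "K \<in> graph_components (del_edges G2 F)" "has_tail_in s (Pow K)" by blast
  have "has_tail_in s (- (\<lambda>j. line_map \<phi> (r j)) ` {..<N})"
    using s(1) by (intro inj_has_tail_in_avoid) (auto simp: ray_def)
  then obtain i where i: "s i \<subseteq> K" "s i \<notin> (\<lambda>j. line_map \<phi> (r j)) ` {..<N}"
    using has_tail_in_both[OF K(2)] by blast
  obtain j where j: "s i = line_map \<phi> (r j)" using s(2) by blast
  then have "\<not> j < N" using i(2) by auto
  then have "j \<ge> N" by simp
  then have "s i \<subseteq> push \<rho> F" using N j by simp
  moreover have "s i \<noteq> {}" using simple_graph_edge(1)[OF simple2] ray_nth[OF s(1)] by simp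
  ultimately have "K = push \<rho> F"
    using components_eqI[OF K(1) push_component(1)[OF assms(1,2)]] i(1) by blast
  then show ?thesis using K(2) by simp
qed

text \<open>\<open>end_map\<close> is a union of classes over all representatives and all rays in
  their images, hence an end only once these classes agree. They do, because each such ray has its
  tail in the same component for every \<open>F\<close>; that some ray exists follows from the
  finite fibres of the image sequence.\<close>

lemma end_map_direction:
  assumes "\<epsilon> \<in> ends (line_graph G1)"
  defines "\<eta> \<equiv> end_map (line_graph G2) (line_map \<phi>) \<epsilon>"
  shows "\<eta> \<in> ends (line_graph G2)"
    and "F \<in> fin_edge_sets G2 \<Longrightarrow> end_to_direction G2 \<eta> F = push (end_to_direction G1 \<epsilon>) F"
proof -
  let ?\<rho> = "end_to_direction G1 \<epsilon>"
  have \<rho>: "?\<rho> \<in> edge_directions G1" using end_to_direction_in[OF simple1 assms(1)] .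
  have ray: "ray (line_graph G1) r" if "r \<in> \<epsilon>" for r
    using ends_ray(1)[OF simple_line_graph assms(1) that] .
  have tail: "has_tail_in s (Pow (push ?\<rho> F))"
    if "F \<in> fin_edge_sets G2" "r \<in> \<epsilon>" "ray_in_image (line_graph G2) (line_map \<phi>) r s" for F r s
    using ray_in_image_tail[OF \<rho> that(1) end_to_direction_component(2)[OF simple1 assms(1) that(2) pull_fin[OF that(1)]]
        ray[OF that(2)] that(3)] .
  obtain r where r: "r \<in> \<epsilon>" using ends_nonempty[OF simple_line_graph assms(1)] by blast
  obtain s where s: "ray_in_image (line_graph G2) (line_map \<phi>) r s"
    using ray_in_finite_fibre_sequence[of "\<lambda>n. line_map \<phi> (r n)" "line_graph G2"] image_sequence[OF ray[OF r]]
    unfolding ray_in_image_def by auto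
  then have ray_s: "ray (line_graph G2) s" by (simp add: ray_in_image_def)
  have "ray_equiv (line_graph G2) `` {s'} = ray_equiv (line_graph G2) `` {s}"
    if s': "r' \<in> \<epsilon>" "ray_in_image (line_graph G2) (line_map \<phi>) r' s'" for r' s'
  proof (rule equiv_class_eq[OF equiv_ray_equiv[OF simple_line_graph]], rule line_ray_equivI[OF simple2 _ ray_s])
    show "ray (line_graph G2) s'" using s'(2) by (simp add: ray_in_image_def)
    show "\<exists>K\<in>graph_components (del_edges G2 F). has_tail_in s' (Pow K) \<and> has_tail_in s (Pow K)"
      if F: "F \<in> fin_edge_sets G2" for F
      using tail[OF F r s] tail[OF F s'] push_component(1)[OF \<rho> F] by blast
  qed
  then have \<eta>: "\<eta> = ray_equiv (line_graph G2) `` {s}"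
    unfolding \<eta>_def end_map_def using r s by blast
  show ends: "\<eta> \<in> ends (line_graph G2)" unfolding \<eta> by (rule ray_equiv_class_end[OF ray_s])
  have "s \<in> \<eta>" unfolding \<eta> by (rule ray_in_class[OF simple_line_graph ray_s])
  then show "end_to_direction G2 \<eta> F = push ?\<rho> F" if "F \<in> fin_edge_sets G2"
    using end_to_direction_eq(1)[OF simple2 ends _ that push_component(1)[OF \<rho> that] tail[OF that r s]] by blast
qed

lemma direction_map_end:
  assumes "\<rho> \<in> edge_directions G1"
  shows "direction_map_end G1 G2 \<phi> \<rho> \<in> edge_directions G2"
    and "F \<in> fin_edge_sets G2 \<Longrightarrow> direction_map_end G1 G2 \<phi> \<rho> F = push \<rho> F"
proof -
  define \<epsilon> where "\<epsilon> = inv_into (ends (line_graph G1)) (end_to_direction G1) \<rho>"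
  have im: "\<rho> \<in> end_to_direction G1 ` ends (line_graph G1)"
    using end_to_direction_image[OF simple1 conn1] assms by simp
  have \<epsilon>: "\<epsilon> \<in> ends (line_graph G1)" "end_to_direction G1 \<epsilon> = \<rho>"
    unfolding \<epsilon>_def by (rule inv_into_into[OF im], rule f_inv_into_f[OF im])
  have D: "direction_map_end G1 G2 \<phi> \<rho> = end_to_direction G2 (end_map (line_graph G2) (line_map \<phi>) \<epsilon>)"
    using assms by (simp add: direction_map_end_def \<epsilon>_def)
  show "direction_map_end G1 G2 \<phi> \<rho> \<in> edge_directions G2"
    unfolding D by (rule end_to_direction_in[OF simple2 end_map_direction(1)[OF \<epsilon>(1)]])
  show "direction_map_end G1 G2 \<phi> \<rho> F = push \<rho> F" if "F \<in> fin_edge_sets G2"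
    using end_map_direction(2)[OF \<epsilon>(1) that] unfolding D \<epsilon>(2) .
qed

section \<open>Preimages of cuts and the map on ultrafilters\<close>

lemma preimage_edge_boundary:
  "edge_boundary G1 (\<phi> -` A \<inter> verts G1) \<subseteq> pull (edge_boundary G2 A)"
proof
  fix e assume e: "e \<in> edge_boundary G1 (\<phi> -` A \<inter> verts G1)"
  then have "e \<in> edges G1" by (simp add: edge_boundary_def)
  moreover obtain x y where "x \<in> e" "\<phi> x \<in> A" "y \<in> e" "\<phi> y \<notin> A" "y \<in> verts G1"
    using e by (auto simp: edge_boundary_def)
  ultimately show "e \<in> pull (edge_boundary G2 A)"
    using line_map_edge hom_verts by (auto simp: pull_def edge_boundary_def line_map_def)
qed

lemma preimage_cut_sets: "A \<in> cut_sets G2 \<Longrightarrow> \<phi> -` A \<inter> verts G1 \<in> cut_sets G1"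
  using fin_edge_sets_subset[OF pull_fin preimage_edge_boundary] by (simp add: cut_sets_iff)

text \<open>Unless \<open>G1\<close> is a single vertex, each of its vertices lies on an edge; so a vertex of finite
  degree has only finitely many preimages.\<close>

lemma preimage_cut_ideal:
  assumes "A \<in> cut_ideal G2"
  shows "\<phi> -` A \<inter> verts G1 \<in> cut_ideal G1"
proof -
  let ?P = "\<phi> -` A \<inter> verts G1"
  have A: "finite A" "\<And>v. v \<in> A \<Longrightarrow> \<not> infinite_degree G2 v"
    using assms by (auto simp: cut_ideal_def)
  have deg: "\<not> infinite_degree G1 v" if "v \<in> ?P" for v
    using image_infinite_degree A(2) that by auto
  have "finite ?P"
  proof (cases "\<exists>v. verts G1 \<subseteq> {v}")
    case False
    define E where "E = {e \<in> edges G2. e \<inter> A \<noteq> {}}"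
    have "E \<subseteq> (\<Union>v\<in>A. {e \<in> edges G2. v \<in> e})" by (auto simp: E_def)
    moreover have "finite {e \<in> edges G2. v \<in> e}" if "v \<in> A" for v
    proof (cases "v \<in> verts G2")
      case False
      then have "{e \<in> edges G2. v \<in> e} = {}" using simple_graph_edge(3)[OF simple2] by blast
      then show ?thesis by (simp only: finite.emptyI)
    qed (use A(2)[OF that] in \<open>simp add: infinite_degree_def\<close>)
    ultimately have "finite E" using A(1) by (meson finite_UN_I finite_subset)
    then have "finite (pull E)" by (rule finite_pull) (auto simp: E_def)
    moreover have "?P \<subseteq> \<Union>(pull E)"
    proof
      fix v assume v: "v \<in> ?P"
      have "\<exists>w. {v, w} \<in> edges G1"
      proof (rule ccontr)
        assume "\<nexists>w. {v, w} \<in> edges G1"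
        then have "component_of G1 v \<subseteq> {v}" by (intro component_of_least) auto
        moreover have "verts G1 \<subseteq> component_of G1 v" using conn1 v by (auto simp: connected_graph_def)
        ultimately show False using False by blast
      qed
      then obtain w where w: "{v, w} \<in> edges G1" ..
      then have "{v, w} \<in> pull E"
        using hom_edge[OF w] v by (auto simp: pull_def E_def line_map_def)
      then show "v \<in> \<Union>(pull E)" by blast
    qed
    moreover have "finite (\<Union>(pull E))" if "finite (pull E)"
      using that simple_graph_edge(2)[OF simple1] by (auto simp: pull_def)
    ultimately show ?thesis by (meson finite_subset)
  qed (auto dest: finite_subset)
  then show ?thesis using deg by (auto simp: cut_ideal_def)
qed

lemma cut_hom_class:
  assumes "A \<in> cut_sets G2"
  shows "cut_hom G1 \<phi> (cut_class G2 A) = cut_class G1 (\<phi> -` A \<inter> verts G1)"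
proof -
  have "congruent (cut_rel G2) (\<lambda>A. cut_class G1 (\<phi> -` A \<inter> verts G1))"
  proof (rule congruentI)
    fix A B assume "(A, B) \<in> cut_rel G2"
    note AB = cut_relD[OF this]
    have ideal: "\<phi> -` ((A - B) \<union> (B - A)) \<inter> verts G1 \<in> cut_ideal G1"
      using preimage_cut_ideal AB by blast
    show "cut_class G1 (\<phi> -` A \<inter> verts G1) = cut_class G1 (\<phi> -` B \<inter> verts G1)"
      by (rule cut_class_eqI, rule cut_relI[OF _ _ _ ideal]) (use AB preimage_cut_sets in blast)+
  qed
  from UN_equiv_class[OF equiv_cut_rel this assms] show ?thesis by (simp add: cut_hom_def)
qed

text \<open>The preimage of a component \<open>K\<close> of \<open>G2\<close> without
  \<open>F\<close> has its boundary inside \<open>pull F\<close>. Whether it belongs to the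
  ultrafilter is thus decided by \<open>\<rho> (pull F)\<close>, whose image lies in exactly one
  such \<open>K\<close>.\<close>

lemma direction_map_ult:
  assumes "\<rho> \<in> edge_directions G1" "F \<in> fin_edge_sets G2"
  shows "direction_map_ult G1 G2 \<phi> \<rho> F = push \<rho> F"
proof -
  define u where "u = inv_into (Ult (cut_algebra G1)) (ult_to_direction G1) \<rho>"
  have im: "\<rho> \<in> ult_to_direction G1 ` Ult (cut_algebra G1)"
    using ult_to_direction_image[OF simple1 conn1] assms(1) by simp
  have u: "u \<in> Ult (cut_algebra G1)" "ult_to_direction G1 u = \<rho>"
    unfolding u_def by (rule inv_into_into[OF im], rule f_inv_into_f[OF im])
  have D: "direction_map_ult G1 G2 \<phi> \<rho> =
      ult_to_direction G2 (ult_map (cut_algebra G2) (cut_hom G1 \<phi>) u)"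
    using assms(1) by (simp add: direction_map_ult_def u_def)
  have "cut_class G2 K \<in> ult_map (cut_algebra G2) (cut_hom G1 \<phi>) u \<longleftrightarrow> K = push \<rho> F"
    if K: "K \<in> graph_components (del_edges G2 F)" for K
  proof -
    have cut: "K \<in> cut_sets G2" by (rule component_in_cut_sets[OF simple2 assms(2) K])
    have "edge_boundary G1 (\<phi> -` K \<inter> verts G1) \<subseteq> pull F"
      using preimage_edge_boundary component_edge_boundary[OF simple2 K] unfolding pull_def by fast
    then have "cut_class G1 (\<phi> -` K \<inter> verts G1) \<in> u \<longleftrightarrow> \<rho> (pull F) \<subseteq> \<phi> -` K \<inter> verts G1"
      using Ult_mem_iff[OF simple1 conn1 u(1) preimage_cut_sets[OF cut] pull_fin[OF assms(2)]] u(2) by simp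
    also have "\<dots> \<longleftrightarrow> \<phi> ` \<rho> (pull F) \<subseteq> K"
      using components_subset_verts[OF simple_del_edges[OF simple1] edge_directionsD(1)[OF assms(1) pull_fin[OF assms(2)]]]
      by auto
    also have "\<dots> \<longleftrightarrow> K = push \<rho> F"
      using push_unique[OF assms] push_component[OF assms] K by blast
    finally show ?thesis using cut_hom_class[OF cut] cut by (simp add: ult_map_def)
  qed
  then show ?thesis
    unfolding D using push_component(1)[OF assms] by (intro ult_to_direction_eq[OF assms(2)])
qed

lemma direction_map_ult_eq_end: "direction_map_ult G1 G2 \<phi> = direction_map_end G1 G2 \<phi>"
proof (rule extensionalityI)
  show "direction_map_ult G1 G2 \<phi> \<in> extensional (edge_directions G1)"
    by (simp add: direction_map_ult_def)
  show "direction_map_end G1 G2 \<phi> \<in> extensional (edge_directions G1)"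
    by (simp add: direction_map_end_def)
  fix \<rho> assume \<rho>: "\<rho> \<in> edge_directions G1"
  show "direction_map_ult G1 G2 \<phi> \<rho> = direction_map_end G1 G2 \<phi> \<rho>"
  proof (rule extensionalityI[OF _ edge_directionsD(4)[OF direction_map_end(1)[OF \<rho>]]])
    show "direction_map_ult G1 G2 \<phi> \<rho> \<in> extensional (fin_edge_sets G2)"
      using \<rho> by (simp add: direction_map_ult_def ult_to_direction_def)
  qed (simp add: direction_map_ult[OF \<rho>] direction_map_end(2)[OF \<rho>])
qed

lemma direction_map_vertex:
  assumes "infinite_degree G1 v"
  shows "direction_map_end G1 G2 \<phi> (vertex_direction G1 v) = vertex_direction G2 (\<phi> v)"
proof -
  note \<rho> = vertex_direction_in[OF simple1 assms]
  show ?thesis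
  proof (rule edge_directions_eqI[OF direction_map_end(1)[OF \<rho>]
        vertex_direction_in[OF simple2 image_infinite_degree[OF assms]]], intro exI conjI)
    fix F assume F: "F \<in> fin_edge_sets G2"
    have "v \<in> vertex_direction G1 v (pull F)" using pull_fin[OF F] by (simp add: vertex_direction_def)
    then show "\<phi> v \<in> direction_map_end G1 G2 \<phi> (vertex_direction G1 v) F"
      using push_component(2)[OF \<rho> F] direction_map_end(2)[OF \<rho> F] by auto
    show "\<phi> v \<in> vertex_direction G2 (\<phi> v) F" using F by (simp add: vertex_direction_def)
  qed
qed

section \<open>Directions of rays and uniqueness of their images\<close>

context
  fixes r assumes r: "ray G1 r"
begin

lemma direction_map_ray_tail:
  assumes "F \<in> fin_edge_sets G2"
  shows "\<exists>n. \<forall>m\<ge>n. \<phi> (r m) \<in> direction_map_end G1 G2 \<phi> (ray_direction G1 r) F"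
proof -
  note \<rho> = ray_direction_in[OF simple1 r]
  show ?thesis
    using ray_direction_component(2)[OF simple1 r pull_fin[OF assms]] push_component(2)[OF \<rho> assms]
      direction_map_end(2)[OF \<rho> assms] unfolding has_tail_in_def by (metis image_subset_iff)
qed

lemma direction_map_ray_meets:
  "always_meets G2 (direction_map_end G1 G2 \<phi> (ray_direction G1 r)) (\<phi> ` r ` {n..})"
  unfolding always_meets_def
proof
  fix F assume "F \<in> fin_edge_sets G2"
  from direction_map_ray_tail[OF this] obtain m where
    "\<forall>k\<ge>m. \<phi> (r k) \<in> direction_map_end G1 G2 \<phi> (ray_direction G1 r) F" ..
  then have "\<phi> (r (max m n)) \<in> direction_map_end G1 G2 \<phi> (ray_direction G1 r) F \<inter> \<phi> ` r ` {n..}" by auto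
  then show "direction_map_end G1 G2 \<phi> (ray_direction G1 r) F \<inter> \<phi> ` r ` {n..} \<noteq> {}" by blast
qed

text \<open>For each \<open>F\<close> a whole tail of the image lies in the value of the induced
  direction, and \<open>\<rho> F\<close> meets that tail. A common vertex is only guaranteed this
  far out.\<close>

lemma always_meets_tails_unique:
  assumes "\<rho> \<in> edge_directions G2" "\<And>n. always_meets G2 \<rho> (\<phi> ` r ` {n..})"
  shows "\<rho> = direction_map_end G1 G2 \<phi> (ray_direction G1 r)"
proof (rule edge_directions_eqI[OF assms(1) direction_map_end(1)[OF ray_direction_in[OF simple1 r]]])
  fix F assume F: "F \<in> fin_edge_sets G2"
  from direction_map_ray_tail[OF F] obtain n where
    "\<forall>m\<ge>n. \<phi> (r m) \<in> direction_map_end G1 G2 \<phi> (ray_direction G1 r) F" ..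
  moreover have "\<rho> F \<inter> \<phi> ` r ` {n..} \<noteq> {}" using assms(2) F by (simp add: always_meets_def)
  ultimately show "\<exists>x. x \<in> \<rho> F \<and> x \<in> direction_map_end G1 G2 \<phi> (ray_direction G1 r) F" by auto
qed

text \<open>If \<open>\<rho>\<close> misses a tail of the image at some \<open>F0\<close>, then for
  every \<open>F\<close> its value at \<open>F \<union> F0\<close> has to meet the finite initial
  part. That makes \<open>\<rho>\<close> the direction of a vertex in this part, which is
  excluded.\<close>

lemma always_meets_image_unique:
  assumes "\<rho> \<in> edge_directions G2" "always_meets G2 \<rho> (\<phi> ` range r)"
    and not_vertex: "\<And>v. v \<in> \<phi> ` range r \<Longrightarrow> infinite_degree G2 v \<Longrightarrow> \<rho> \<noteq> vertex_direction G2 v"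
  shows "\<rho> = direction_map_end G1 G2 \<phi> (ray_direction G1 r)"
proof (rule always_meets_tails_unique[OF assms(1)], rule ccontr)
  fix n assume "\<not> always_meets G2 \<rho> (\<phi> ` r ` {n..})"
  then obtain F0 where F0: "F0 \<in> fin_edge_sets G2" "\<rho> F0 \<inter> \<phi> ` r ` {n..} = {}"
    by (auto simp: always_meets_def)
  have "\<rho> F \<inter> \<phi> ` r ` {..<n} \<noteq> {}" if F: "F \<in> fin_edge_sets G2" for F
  proof -
    have "\<rho> (F \<union> F0) \<inter> \<phi> ` range r \<noteq> {}"
      using assms(2) fin_edge_sets_Un[OF F F0(1)] by (simp add: always_meets_def)
    then obtain k where k: "\<phi> (r k) \<in> \<rho> (F \<union> F0)" by blast
    then have "\<phi> (r k) \<in> \<rho> F" "\<phi> (r k) \<in> \<rho> F0" using edge_directions_Un[OF assms(1) F F0(1)] by blast+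
    moreover have "k < n"
    proof (rule ccontr)
      assume "\<not> k < n"
      then have "\<phi> (r k) \<in> \<rho> F0 \<inter> \<phi> ` r ` {n..}" using \<open>\<phi> (r k) \<in> \<rho> F0\<close> by simp
      then show False using F0(2) by simp
    qed
    ultimately show ?thesis by blast
  qed
  then have "always_meets G2 \<rho> (\<phi> ` r ` {..<n})" by (simp add: always_meets_def)
  from always_meets_eq_vertex_direction[OF simple2 assms(1) _ this]
  obtain v where v: "v \<in> \<phi> ` r ` {..<n}" "infinite_degree G2 v" "\<rho> = vertex_direction G2 v"
    by auto
  then have "v \<in> \<phi> ` range r" by auto
  then show False using not_vertex[OF _ v(2)] v(3) by blast
qed

end

end

theorem proposition24:
  fixes G1 :: "'a graph" and G2 :: "'b graph" and \<phi> :: "'a \<Rightarrow> 'b"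
  assumes "simple_graph G1" and "simple_graph G2"
    and "connected_graph G1" and "connected_graph G2"
    and "strongly_line_proper G1 G2 \<phi>"
  shows "canonical_identifications G1 \<and> canonical_identifications G2 \<and>
    (\<exists>D. D = direction_map_ult G1 G2 \<phi> \<and> D = direction_map_end G1 G2 \<phi> \<and>
      D \<in> edge_directions G1 \<rightarrow> edge_directions G2 \<and>
      (\<forall>v. infinite_degree G1 v \<longrightarrow>
         vertex_direction G1 v \<in> edge_directions G1 \<and>
         infinite_degree G2 (\<phi> v) \<and>
         D (vertex_direction G1 v) = vertex_direction G2 (\<phi> v)) \<and>
      (\<forall>r. ray G1 r \<longrightarrow>
         ray_direction G1 r \<in> edge_directions G1 \<and>
         always_meets G2 (D (ray_direction G1 r)) (\<phi> ` range r) \<and>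
         (\<forall>\<rho>\<in>edge_directions G2.
            (\<forall>n. always_meets G2 \<rho> (\<phi> ` r ` {n..})) \<longleftrightarrow> \<rho> = D (ray_direction G1 r)) \<and>
         (\<forall>\<rho>\<in>edge_directions G2.
            always_meets G2 \<rho> (\<phi> ` range r) \<and>
            (\<forall>v\<in>\<phi> ` range r. infinite_degree G2 v \<longrightarrow> \<rho> \<noteq> vertex_direction G2 v) \<longrightarrow>
            \<rho> = D (ray_direction G1 r))))"
proof -
  interpret line_proper_morphism G1 G2 \<phi>
    using assms by unfold_locales
  let ?D = "direction_map_end G1 G2 \<phi>"
  have vertex: "vertex_direction G1 v \<in> edge_directions G1 \<and> infinite_degree G2 (\<phi> v) \<and>
      ?D (vertex_direction G1 v) = vertex_direction G2 (\<phi> v)" if "infinite_degree G1 v" for v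
    using vertex_direction_in[OF simple1 that] image_infinite_degree[OF that] direction_map_vertex[OF that] by blast
  have ray: "ray_direction G1 r \<in> edge_directions G1 \<and>
      always_meets G2 (?D (ray_direction G1 r)) (\<phi> ` range r) \<and>
      (\<forall>\<rho>\<in>edge_directions G2.
        (\<forall>n. always_meets G2 \<rho> (\<phi> ` r ` {n..})) \<longleftrightarrow> \<rho> = ?D (ray_direction G1 r)) \<and>
      (\<forall>\<rho>\<in>edge_directions G2.
        always_meets G2 \<rho> (\<phi> ` range r) \<and>
        (\<forall>v\<in>\<phi> ` range r. infinite_degree G2 v \<longrightarrow> \<rho> \<noteq> vertex_direction G2 v) \<longrightarrow>
        \<rho> = ?D (ray_direction G1 r))" if r: "ray G1 r" for r
  proof (intro conjI ballI iffI impI allI)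
    show "ray_direction G1 r \<in> edge_directions G1" by (rule ray_direction_in[OF simple1 r])
    show "always_meets G2 (?D (ray_direction G1 r)) (\<phi> ` range r)"
      using direction_map_ray_meets[OF r, of 0] by simp
    fix \<rho> assume \<rho>: "\<rho> \<in> edge_directions G2"
    show "\<rho> = ?D (ray_direction G1 r)" if "\<forall>n. always_meets G2 \<rho> (\<phi> ` r ` {n..})"
      using always_meets_tails_unique[OF r \<rho>] that by blast
    show "always_meets G2 \<rho> (\<phi> ` r ` {n..})" if "\<rho> = ?D (ray_direction G1 r)" for n
      unfolding that by (rule direction_map_ray_meets[OF r])
    show "\<rho> = ?D (ray_direction G1 r)" if "always_meets G2 \<rho> (\<phi> ` range r) \<and>
        (\<forall>v\<in>\<phi> ` range r. infinite_degree G2 v \<longrightarrow> \<rho> \<noteq> vertex_direction G2 v)"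
      using always_meets_image_unique[OF r \<rho>] that by blast
  qed
  show ?thesis
  proof (intro conjI exI[of _ ?D])
    show "canonical_identifications G1" "canonical_identifications G2"
      by (fact canonical_identificationsI[OF simple1 conn1] canonical_identificationsI[OF simple2 conn2])+
    show "?D = direction_map_ult G1 G2 \<phi>" by (rule direction_map_ult_eq_end[symmetric])
    show "?D \<in> edge_directions G1 \<rightarrow> edge_directions G2" using direction_map_end(1) by blast
  qed (use vertex ray in simp_all)
qed

end
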